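(* Let $Q\ge2$, let $\alpha=(\alpha_1,\dots,\alpha_Q)$ be a probability vector with positive entries and $\pi=(\pi_{qr})_{q,r\in[Q]}$ a symmetric matrix with entries in $[0,1]$, such that $\overline{\pi}_q\ne\overline{\pi}_r$ whenever $q\neq r$, where $\overline{\pi}_q=\sum_{r}\alpha_r\pi_{qr}$. Let $\delta=\min_{q\ne r}|\overline{\pi}_q-\overline{\pi}_r|$ and $\alpha_0=\min_q\alpha_q$. Let the graph be drawn from the Stochastic Block Model $\mathcal{G}(n,\pi,\alpha)$ and let $(\widehat\alpha,\widehat\pi)$ be the plug-in estimators built from the partition returned by the Largest Gaps (LG) algorithm with input $Q$. Then for all $t>0$, $$P\big(\|(\widehat\alpha,\widehat\pi)-(\alpha,\pi)\|_\infty>t\big)\le 2Q^2\Big(e^{-n^2t^2(\alpha_0^2-n^{-1/4})}+4e^{-\frac12\sqrt n}\Big)+2Qe^{-2nt^2}+2ne^{-\frac18n\delta^2}+Q(1-\alpha_0)^n.$$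
   Context: Notation: $[n]=\{1,\dots,n\}$. Stochastic Block Model $\mathcal{G}(n,\pi,\alpha)$: the labels $Z_1,\dots,Z_n$ are i.i.d. in $[Q]$ with $P(Z_i=q)=\alpha_q$; $X$ is the adjacency matrix of an undirected graph on $[n]$ without self-loops ($X_{ij}=X_{ji}$), and conditionally on $Z$ the variables $X_{ij}$, $i<j$, are independent, $X_{ij}$ being Bernoulli with parameter $\pi_{Z_iZ_j}$. True classes: $\mathcal{C}_q=\{i\in[n]: Z_i=q\}$; the true partition is $\{\mathcal{C}_q\}_{q\in[Q]}$. Normalized degrees: $T_i=\frac{1}{n-1}\sum_{j\ne i}X_{ij}$. LG algorithm with input $Q$ ($n\ge Q$, $n\ge2$): sort $T_{(1)}\le\dots\le T_{(n)}$ (here $(i)$ also denotes the node in position $i$ of the ordering); find indices $i_1<\dots<i_{Q-1}$ in $[n-1]$ of the $Q-1$ largest gaps, i.e. $T_{(i_k+1)}-T_{(i_k)}\ge T_{(i+1)}-T_{(i)}$ for all $k\in[Q-1]$ and all $i\in[n-1]\setminus\{i_1,\dots,i_{Q-1}\}$ (ties broken arbitrarily); with $i_0=0$, $i_Q=n$, the estimated classes are the $Q$ sets of nodes $(i)$ with $i_{k-1}<i\le i_k$, $k\in[Q]$. Plug-in estimators: with estimated classes $\widehat{\mathcal{C}}_q$ of cardinality $\widehat N_q$, $\widehat\alpha_q=\widehat N_q/n$; for $q\ne r$, $\widehat\pi_{qr}=\frac{1}{\widehat N_q\widehat N_r}\sum_{i\in\widehat{\mathcal{C}}_q,\,j\in\widehat{\mathcal{C}}_r}X_{ij}$;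 and $\widehat\pi_{qq}=\frac{2}{\widehat N_q(\widehat N_q-1)}\sum_{i<j,\; i,j\in\widehat{\mathcal{C}}_q}X_{ij}$ (any fixed value in $[0,1]$ is used when the denominator is zero). Label convention: classes are identified only up to a permutation of labels; the labels of the estimated classes are matched with the true ones, in the sense that whenever the estimated partition equals the true partition as a set of blocks, $\widehat{\mathcal{C}}_q=\mathcal{C}_q$ for all $q$. $\|\cdot\|_\infty$ is the maximum of the absolute values of all coordinates. *)

theory Defs
  imports "HOL-Probability.Probability" "HOL-Combinatorics.Permutations"
begin

text \<open>Nodes are the elements of \<open>{1..n}\<close> and class labels the elements of \<open>{1..Q}\<close>; parameters
  \<open>\<alpha> q\<close>, \<open>\<pi> q r\<close> and classes \<open>C q\<close> only matter for labels in \<open>{1..Q}\<close>.\<close>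

text \<open>Conditioning on \<open>Z = z\<close>, for a value \<open>z\<close> of positive probability, is expressed by
  \<^const>\<open>uniform_measure\<close> \<open>M {\<omega> \<in> space M. \<forall>i\<in>{1..n}. Z i \<omega> = z i}\<close>, the measure
  \<open>B \<mapsto> P(B \<inter> {Z = z}) / P(Z = z)\<close>.\<close>

locale sbm = prob_space M
  for M :: "'a measure" +
  fixes n Q :: nat
    and \<pi> :: "nat \<Rightarrow> nat \<Rightarrow> real"
    and \<alpha> :: "nat \<Rightarrow> real"
    and Z :: "nat \<Rightarrow> 'a \<Rightarrow> nat"
    and X :: "nat \<Rightarrow> nat \<Rightarrow> 'a \<Rightarrow> bool"
  assumes labels_range: "\<And>i \<omega>. i \<in> {1..n} \<Longrightarrow> \<omega> \<in> space M \<Longrightarrow> Z i \<omega> \<in> {1..Q}"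
    and labels_indep: "indep_vars (\<lambda>_. count_space UNIV) Z {1..n}"
    and labels_prob: "\<And>i q. i \<in> {1..n} \<Longrightarrow> q \<in> {1..Q} \<Longrightarrow>
          prob {\<omega> \<in> space M. Z i \<omega> = q} = \<alpha> q"
    and edges_rv: "\<And>i j. i \<in> {1..n} \<Longrightarrow> j \<in> {1..n} \<Longrightarrow>
          random_variable (count_space UNIV) (X i j)"
    and edges_sym: "\<And>i j \<omega>. i \<in> {1..n} \<Longrightarrow> j \<in> {1..n} \<Longrightarrow> \<omega> \<in> space M \<Longrightarrow>
          X i j \<omega> = X j i \<omega>"
    and no_loops: "\<And>i \<omega>. i \<in> {1..n} \<Longrightarrow> \<omega> \<in> space M \<Longrightarrow> \<not> X i i \<omega>"
    and edges_cond_indep: "\<And>z. prob {\<omega> \<in> space M. \<forall>i\<in>{1..n}. Z i \<omega> = z i} > 0 \<Longrightarrow>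
          prob_space.indep_vars
            (uniform_measure M {\<omega> \<in> space M. \<forall>i\<in>{1..n}. Z i \<omega> = z i})
            (\<lambda>_. count_space UNIV) (\<lambda>(i, j). X i j) {(i, j). 1 \<le> i \<and> i < j \<and> j \<le> n}"
    and edges_cond_bernoulli: "\<And>z i j. prob {\<omega> \<in> space M. \<forall>i\<in>{1..n}. Z i \<omega> = z i} > 0 \<Longrightarrow>
          1 \<le> i \<Longrightarrow> i < j \<Longrightarrow> j \<le> n \<Longrightarrow>
          distr (uniform_measure M {\<omega> \<in> space M. \<forall>i\<in>{1..n}. Z i \<omega> = z i})
            (count_space UNIV) (X i j) = measure_pmf (bernoulli_pmf (\<pi> (z i) (z j)))"

definition true_class :: "nat \<Rightarrow> (nat \<Rightarrow> nat) \<Rightarrow> nat \<Rightarrow> nat set" where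
  "true_class n z q = {i \<in> {1..n}. z i = q}"

definition norm_degree :: "nat \<Rightarrow> (nat \<Rightarrow> nat \<Rightarrow> bool) \<Rightarrow> nat \<Rightarrow> real" where
  "norm_degree n A i = (\<Sum>j\<in>{1..n} - {i}. of_bool (A i j)) / (real n - 1)"

text \<open>\<open>\<sigma> i\<close> is the node in position \<open>i\<close> of an ordering by normalized degree, and
  \<open>c 1 < \<dots> < c (Q - 1)\<close> are positions of \<open>Q - 1\<close> largest gaps. The relation holds for every
  output that some way of breaking ties produces, with the classes listed by increasing degree.\<close>

definition LG_output ::
    "nat \<Rightarrow> nat \<Rightarrow> (nat \<Rightarrow> nat \<Rightarrow> bool) \<Rightarrow> (nat \<Rightarrow> nat set) \<Rightarrow> bool" where
  "LG_output n Q A B \<longleftrightarrow> (\<exists>\<sigma> c.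
     bij_betw \<sigma> {1..n} {1..n} \<and>
     (\<forall>i\<in>{1..n}. \<forall>j\<in>{1..n}. i \<le> j \<longrightarrow> norm_degree n A (\<sigma> i) \<le> norm_degree n A (\<sigma> j)) \<and>
     c 0 = 0 \<and> c Q = n \<and>
     strict_mono_on {1..Q - 1} c \<and> c ` {1..Q - 1} \<subseteq> {1..n - 1} \<and>
     (\<forall>k\<in>{1..Q - 1}. \<forall>i\<in>{1..n - 1} - c ` {1..Q - 1}.
        norm_degree n A (\<sigma> (c k + 1)) - norm_degree n A (\<sigma> (c k))
          \<ge> norm_degree n A (\<sigma> (i + 1)) - norm_degree n A (\<sigma> i)) \<and>
     (\<forall>k\<in>{1..Q}. B k = \<sigma> ` {c (k - 1)<..c k}))"

definition LG_classes ::
    "nat \<Rightarrow> nat \<Rightarrow> (nat \<Rightarrow> nat \<Rightarrow> bool) \<Rightarrow> (nat \<Rightarrow> nat set) \<Rightarrow> bool" where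
  "LG_classes n Q A C \<longleftrightarrow>
     (\<exists>B \<tau>. LG_output n Q A B \<and> \<tau> permutes {1..Q} \<and> (\<forall>q\<in>{1..Q}. C q = B (\<tau> q)))"

definition labels_matched :: "nat \<Rightarrow> (nat \<Rightarrow> nat set) \<Rightarrow> (nat \<Rightarrow> nat set) \<Rightarrow> bool" where
  "labels_matched Q C C' \<longleftrightarrow>
     (C ` {1..Q} = C' ` {1..Q} \<longrightarrow> (\<forall>q\<in>{1..Q}. C q = C' q))"

definition alpha_hat :: "nat \<Rightarrow> (nat \<Rightarrow> nat set) \<Rightarrow> nat \<Rightarrow> real" where
  "alpha_hat n C q = real (card (C q)) / real n"

text \<open>\<open>v\<close> is the value used when the denominator vanishes. For classes returned by the algorithm
  this only happens on the diagonal, for singleton classes, since these classes are nonempty.\<close>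

definition pi_hat ::
    "real \<Rightarrow> (nat \<Rightarrow> nat \<Rightarrow> bool) \<Rightarrow> (nat \<Rightarrow> nat set) \<Rightarrow> nat \<Rightarrow> nat \<Rightarrow> real" where
  "pi_hat v A C q r =
     (let N = (\<lambda>s. real (card (C s))) in
      if q = r then
        (if N q * (N q - 1) = 0 then v
         else 2 / (N q * (N q - 1)) *
              (\<Sum>(i, j) \<in> {(i, j). i \<in> C q \<and> j \<in> C q \<and> i < j}. of_bool (A i j)))
      else
        (if N q * N r = 0 then v
         else 1 / (N q * N r) * (\<Sum>(i, j) \<in> C q \<times> C r. of_bool (A i j))))"

text \<open>Sup norm of \<open>(a, p) - (a', p')\<close> over all coordinates.\<close>

definition param_dist ::
    "nat \<Rightarrow> (nat \<Rightarrow> real) \<Rightarrow> (nat \<Rightarrow> nat \<Rightarrow> real) \<Rightarrow> (nat \<Rightarrow> real) \<Rightarrow> (nat \<Rightarrow> nat \<Rightarrow> real) \<Rightarrow> real"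
  where
  "param_dist Q a p a' p' =
     Max ((\<lambda>q. \<bar>a q - a' q\<bar>) ` {1..Q} \<union>
          (\<lambda>(q, r). \<bar>p q r - p' q r\<bar>) ` ({1..Q} \<times> {1..Q}))"

definition pi_bar :: "nat \<Rightarrow> (nat \<Rightarrow> real) \<Rightarrow> (nat \<Rightarrow> nat \<Rightarrow> real) \<Rightarrow> nat \<Rightarrow> real" where
  "pi_bar Q \<alpha> \<pi> q = (\<Sum>r\<in>{1..Q}. \<alpha> r * \<pi> q r)"

definition sep :: "nat \<Rightarrow> (nat \<Rightarrow> real) \<Rightarrow> (nat \<Rightarrow> nat \<Rightarrow> real) \<Rightarrow> real" where
  "sep Q \<alpha> \<pi> =
     Min {\<bar>pi_bar Q \<alpha> \<pi> q - pi_bar Q \<alpha> \<pi> r\<bar> | q r. q \<in> {1..Q} \<and> r \<in> {1..Q} \<and> q \<noteq> r}"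

definition alpha_min :: "nat \<Rightarrow> (nat \<Rightarrow> real) \<Rightarrow> real" where
  "alpha_min Q \<alpha> = Min (\<alpha> ` {1..Q})"

end

theory Submission
  imports Defs
begin

text \<open>If all classes are nonempty and \<open>degree i + 1 / 2\<close> is within \<open>n * \<delta> / 4\<close> of
  \<open>n * pi_bar (Z i)\<close> for every node \<open>i\<close>, then degrees differ by less than \<open>n * \<delta> / 2\<close> inside a
  class and by more between classes, so the \<open>Q - 1\<close> largest gaps are exactly the class boundaries.
  When the partition is recovered, the estimators are empirical means over the true classes.
  Hoeffding's inequality controls the class sizes and, conditionally on the labels, the edge
  densities; the lower tail of the class sizes then removes the conditioning. The degree deviations
  are bounded by exponential moments, averaging over the labels before applying Hoeffding's
  lemma.\<close>

section \<open>Correctness of the largest gaps partition\<close>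

text \<open>The two kinds of edge statistics need opposite treatments of the labels. Given all
  labels, the mean degree of a node depends on the empirical class sizes, whereas the target
  \<open>n * pi_bar\<close> does not; a conditional bound would have to pay for that discrepancy
  separately. Averaging the conditional exponential moment over the labels of the other nodes turns
  the edges at a node of class \<open>q\<close> into independent Bernoulli variables of mean
  \<open>pi_bar Q \<alpha> \<pi> q\<close>, and a single Chernoff bound suffices. For an edge
  density the target \<open>\<pi> q r\<close> is free of the class sizes, but the number of summands
  is not. Hoeffding is therefore applied labeling by labeling, and labelings with a small class are
  paid for by a tail bound. A class of size \<open>N\<close> contains \<open>N * (N - 1) / 2\<close>
  pairs, so the factor 2 in Hoeffding's exponent yields \<open>N * (N - 1)\<close>, of order
  \<open>n ^ 2 * \<alpha>0 ^ 2\<close> at least. The correction \<open>n powr (- 1 / 4)\<close>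
  absorbs both the slack in the class size and the missing \<open>N\<close>.\<close>

lemma LG_output_eq_partition:
  fixes z :: "nat \<Rightarrow> nat" and g :: real
  assumes LG: "LG_output n Q A B" and Q: "Q \<ge> 1"
    and onto: "z ` {1..n} = {1..Q}"
    and near: "\<And>i j. i \<in> {1..n} \<Longrightarrow> j \<in> {1..n} \<Longrightarrow> z i = z j \<Longrightarrow>
      \<bar>norm_degree n A i - norm_degree n A j\<bar> < g"
    and far: "\<And>i j. i \<in> {1..n} \<Longrightarrow> j \<in> {1..n} \<Longrightarrow> z i \<noteq> z j \<Longrightarrow>
      \<bar>norm_degree n A i - norm_degree n A j\<bar> > g"
  shows "B ` {1..Q} = true_class n z ` {1..Q}"
proof -
  from LG obtain \<sigma> c where bij: "bij_betw \<sigma> {1..n} {1..n}"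
    and sorted: "\<forall>i\<in>{1..n}. \<forall>j\<in>{1..n}. i \<le> j \<longrightarrow>
      norm_degree n A (\<sigma> i) \<le> norm_degree n A (\<sigma> j)"
    and c0: "c 0 = 0" and cQ: "c Q = n"
    and c_mono: "strict_mono_on {1..Q - 1} c" and c_range: "c ` {1..Q - 1} \<subseteq> {1..n - 1}"
    and c_gap: "\<forall>k\<in>{1..Q - 1}. \<forall>i\<in>{1..n - 1} - c ` {1..Q - 1}.
        norm_degree n A (\<sigma> (c k + 1)) - norm_degree n A (\<sigma> (c k))
          \<ge> norm_degree n A (\<sigma> (i + 1)) - norm_degree n A (\<sigma> i)"
    and B: "\<forall>k\<in>{1..Q}. B k = \<sigma> ` {c (k - 1)<..c k}"
    unfolding LG_output_def by (elim exE conjE) (rule that)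
  define T where "T i = norm_degree n A (\<sigma> i)" for i
  define w where "w i = z (\<sigma> i)" for i
  define J where "J = {i \<in> {1..n - 1}. w i \<noteq> w (i + 1)}"
  have \<sigma>_in: "\<sigma> i \<in> {1..n}" if "i \<in> {1..n}" for i
    using bij that by (auto simp: bij_betw_def)
  have w_onto: "w ` {1..n} = {1..Q}"
    using onto bij by (simp add: w_def bij_betw_def flip: image_image)
  have "n \<ge> 1" using onto Q by (cases n) auto
  have T_mono: "T i \<le> T j" if "i \<in> {1..n}" "j \<in> {1..n}" "i \<le> j" for i j
    using sorted that by (simp add: T_def)
  have T_near: "\<bar>T i - T j\<bar> < g" if "i \<in> {1..n}" "j \<in> {1..n}" "w i = w j" for i j
    using near[OF \<sigma>_in \<sigma>_in] that by (simp add: T_def w_def)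
  have T_far: "\<bar>T i - T j\<bar> > g" if "i \<in> {1..n}" "j \<in> {1..n}" "w i \<noteq> w j" for i j
    using far[OF \<sigma>_in \<sigma>_in] that by (simp add: T_def w_def)
  \<comment> \<open>Sorting squeezes \<open>T k\<close> between \<open>T i\<close> and
    \<open>T j\<close>, which are less than \<open>g\<close> apart, while a foreign label at
    \<open>k\<close> would put it more than \<open>g\<close> away. Hence every label occupies one
    run of positions.\<close>
  have contiguous: "w k = w i" if "i \<in> {1..n}" "j \<in> {1..n}" "i \<le> k" "k \<le> j" "w i = w j" for i j k
  proof (rule ccontr)
    assume "w k \<noteq> w i"
    moreover have "k \<in> {1..n}" using that by auto
    ultimately show False
      using T_far[of k i] T_near[of i j] T_mono[of i k] T_mono[of k j] that by force
  qed
  \<comment> \<open>Each run ends at a jump or at \<open>n\<close>. Matching these ends bijectively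
    with the labels is what gives exactly \<open>Q - 1\<close> jumps.\<close>
  have last_of_run: "inj_on w (insert n J)"
  proof -
    have "False" if "i \<in> insert n J" "j \<in> insert n J" "w i = w j" "i < j" for i j
    proof -
      from that have "i \<in> J" "i \<in> {1..n}" "j \<in> {1..n}"
        using \<open>n \<ge> 1\<close> by (auto simp: J_def)
      with contiguous[of i j "i + 1"] that show False by (auto simp: J_def)
    qed
    then show ?thesis by (metis inj_onI linorder_neqE_nat)
  qed
  have w_ends: "w ` insert n J = {1..Q}"
  proof (intro equalityI subsetI)
    fix q assume "q \<in> w ` insert n J"
    then have "q \<in> w ` {1..n}" using \<open>n \<ge> 1\<close> by (auto simp: J_def)
    then show "q \<in> {1..Q}" using w_onto by simp
  next
    fix q assume "q \<in> {1..Q}"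
    define P where "P = {i \<in> {1..n}. w i = q}"
    have "q \<in> w ` {1..n}" using \<open>q \<in> {1..Q}\<close> w_onto by simp
    then have "P \<noteq> {}" "finite P" by (auto simp: P_def)
    then have m: "Max P \<in> P" and max: "\<And>i. i \<in> P \<Longrightarrow> i \<le> Max P" by auto
    have "Max P \<in> insert n J"
    proof (rule ccontr)
      assume "Max P \<notin> insert n J"
      moreover have "Max P \<in> {1..n}" "w (Max P) = q" using m by (auto simp only: P_def mem_Collect_eq)
      ultimately have "Max P + 1 \<in> {1..n}" "w (Max P + 1) = q" by (auto simp: J_def)
      then have "Max P + 1 \<in> P" by (auto simp only: P_def mem_Collect_eq)
      then show False using max[of "Max P + 1"] by simp
    qed
    moreover have "w (Max P) = q" using m by (auto simp only: P_def mem_Collect_eq)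
    ultimately show "q \<in> w ` insert n J" by blast
  qed
  have "finite J" "n \<notin> J" using \<open>n \<ge> 1\<close> by (auto simp: J_def)
  have "card (insert n J) = Q"
    using card_image[OF last_of_run] w_ends by simp
  then have card_J: "card J = Q - 1" using \<open>finite J\<close> \<open>n \<notin> J\<close> by simp
  have card_c: "card (c ` {1..Q - 1}) = Q - 1"
    using card_image[OF strict_mono_on_imp_inj_on[OF c_mono]] by simp
  \<comment> \<open>If a jump were left out, every chosen gap would be at least as large as that
    jump's gap, hence above \<open>g\<close>, and so a jump itself. The \<open>Q - 1\<close> cuts
    would then be a proper subset of the \<open>Q - 1\<close> jumps. Gaps at jumps and elsewhere are
    strictly separated by \<open>g\<close>, so tie-breaking cannot interfere.\<close>
  have "J \<subseteq> c ` {1..Q - 1}"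
  proof (rule ccontr)
    assume "\<not> J \<subseteq> c ` {1..Q - 1}"
    then obtain i where i: "i \<in> J" "i \<notin> c ` {1..Q - 1}" by blast
    have "c k \<in> J" if k: "k \<in> {1..Q - 1}" for k
    proof (rule ccontr)
      assume "c k \<notin> J"
      moreover have "c k \<in> {1..n - 1}" using c_range k by blast
      ultimately have "c k \<in> {1..n - 1}" "w (c k) = w (c k + 1)" by (auto simp: J_def)
      moreover have "i \<in> {1..n - 1}" "w i \<noteq> w (i + 1)" using i by (auto simp: J_def)
      ultimately show False
        using c_gap[rule_format, OF k, of i] i T_near[of "c k" "c k + 1"] T_far[of i "i + 1"] T_mono[of i "i + 1"]
        by (force simp: T_def)
    qed
    then have "c ` {1..Q - 1} \<subset> J" using i by blast
    then have "card (c ` {1..Q - 1}) < card J" using \<open>finite J\<close> by (rule psubset_card_mono[rotated])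
    then show False using card_J card_c by simp
  qed
  then have c_eq_J: "c ` {1..Q - 1} = J"
    using card_J card_c by (intro card_subset_eq[symmetric]) auto
  have c_ends: "c ` {1..Q} = insert n J"
  proof -
    have "{1..Q} = insert Q {1..Q - 1}" using Q by auto
    then show ?thesis using c_eq_J cQ by simp
  qed
  \<comment> \<open>Strict monotonicity is given on \<open>{1..Q - 1}\<close> only; this extends it
    to the sentinels \<open>c 0 = 0\<close> and \<open>c Q = n\<close>.\<close>
  have c_less: "c j < c k" if less: "j < k" and le: "k \<le> Q" for j k
  proof -
    have pos: "c k \<in> {1..n}" if "k \<in> {1..Q}" for k
    proof -
      have "c k \<in> insert n J" using c_ends that by blast
      then show ?thesis using \<open>n \<ge> 1\<close> by (auto simp: J_def)
    qed
    consider "j = 0" | "j \<ge> 1" "k = Q" | "j \<ge> 1" "k < Q" using less le by fastforce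
    then show ?thesis
    proof cases
      case 1 then show ?thesis using c0 pos[of k] less le by auto
    next
      case 2
      then have "c j \<in> c ` {1..Q - 1}" using less by (intro imageI) auto
      then have "c j \<in> {1..n - 1}" using c_range by blast
      then show ?thesis using cQ 2 by auto
    next
      case 3
      then have "j \<in> {1..Q - 1}" "k \<in> {1..Q - 1}" using less by auto
      then show ?thesis using less c_mono by (blast dest: strict_mono_onD)
    qed
  qed
  have block: "{c (k - 1)<..c k} = {j \<in> {1..n}. w j = w (c k)}" if k: "k \<in> {1..Q}" for k
  proof -
    have ck: "c k \<in> insert n J" using c_ends k by blast
    then have ckn: "c k \<in> {1..n}" using \<open>n \<ge> 1\<close> by (auto simp: J_def)
    have no_jump: "i \<notin> J" if "c (k - 1) < i" "i < c k" for i
    proof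
      assume "i \<in> J"
      then obtain l where l: "l \<in> {1..Q}" "i = c l" using c_ends by blast
      have "l < k" using that l k c_less[of k l] by (cases l k rule: linorder_cases) auto
      moreover have "k - 1 < l"
      proof (rule ccontr)
        assume "\<not> k - 1 < l"
        moreover have "k - 1 \<le> Q" using k by auto
        ultimately have "c l \<le> c (k - 1)"
          using c_less[of l "k - 1"] by (cases "l = k - 1") auto
        then show False using that l by simp
      qed
      ultimately show False by simp
    qed
    show ?thesis
    proof (intro equalityI subsetI)
      fix j assume j: "j \<in> {c (k - 1)<..c k}"
      then have "j \<le> c k" by simp
      then have "w j = w (c k)"
      proof (induction rule: inc_induct)
        case (step i)
        have "i \<notin> J" using no_jump step j by simp
        then have "w i = w (Suc i)" using step j ckn by (auto simp: J_def)
        then show ?case using step by simp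
      qed simp
      then show "j \<in> {j \<in> {1..n}. w j = w (c k)}" using j ckn by auto
    next
      \<comment> \<open>A position with this label beyond either cut would, by contiguity, carry the
        label across that cut, which is a jump. The ends \<open>0\<close> and \<open>n\<close> of
        the ordering are not jumps but bound \<open>j\<close> directly.\<close>
      fix j assume "j \<in> {j \<in> {1..n}. w j = w (c k)}"
      then have j: "j \<in> {1..n}" "w j = w (c k)" by auto
      have "j \<le> c k"
      proof (rule ccontr)
        assume "\<not> j \<le> c k"
        then have "c k \<in> J" using ck j by auto
        moreover have "w (c k + 1) = w (c k)"
          using contiguous[of "c k" j "c k + 1"] ckn j \<open>\<not> j \<le> c k\<close> by auto
        ultimately show False by (simp add: J_def)
      qed
      moreover have "c (k - 1) < j"
      proof (rule ccontr)
        assume less: "\<not> c (k - 1) < j"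
        then have "k - 1 \<noteq> 0" using c0 j by (metis atLeastAtMost_iff less_le_trans zero_less_one)
        then have "c (k - 1) \<in> c ` {1..Q - 1}" using k by (intro imageI) auto
        then have "c (k - 1) \<in> J" using c_eq_J by simp
        have "c (k - 1) < c k" using c_less[of "k - 1" k] k by auto
        then have "w (c (k - 1)) = w j" "w (c (k - 1) + 1) = w j"
          using less by (auto intro!: contiguous[OF j(1) ckn _ _ j(2)])
        then show False using \<open>c (k - 1) \<in> J\<close> by (simp add: J_def)
      qed
      ultimately show "j \<in> {c (k - 1)<..c k}" by simp
    qed
  qed
  have "B k = true_class n z (w (c k))" if "k \<in> {1..Q}" for k
  proof -
    have "\<sigma> ` {j \<in> {1..n}. w j = q} = true_class n z q" for q
    proof -
      have "\<sigma> ` {j \<in> {1..n}. w j = q} = {i \<in> \<sigma> ` {1..n}. z i = q}"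
        unfolding w_def by auto
      then show ?thesis using bij by (simp add: bij_betw_def true_class_def)
    qed
    then show ?thesis using bspec[OF B that] block[OF that] by simp
  qed
  then have "B ` {1..Q} = (\<lambda>k. true_class n z (w (c k))) ` {1..Q}" by simp
  also have "\<dots> = true_class n z ` w ` c ` {1..Q}" by (simp add: image_image)
  also have "\<dots> = true_class n z ` {1..Q}" using c_ends w_ends by simp
  finally show ?thesis .
qed

text \<open>Permuting labels does not change the set of blocks, so recovery of the partition is
  precisely the premise of \<open>labels_matched\<close>, which upgrades it to equality label by
  label.\<close>

lemma LG_classes_eq_true_class:
  fixes z :: "nat \<Rightarrow> nat" and g :: real
  assumes "LG_classes n Q A C" and "labels_matched Q C (true_class n z)" and "Q \<ge> 1"
    and "z ` {1..n} = {1..Q}"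
    and "\<And>i j. i \<in> {1..n} \<Longrightarrow> j \<in> {1..n} \<Longrightarrow> z i = z j \<Longrightarrow>
      \<bar>norm_degree n A i - norm_degree n A j\<bar> < g"
    and "\<And>i j. i \<in> {1..n} \<Longrightarrow> j \<in> {1..n} \<Longrightarrow> z i \<noteq> z j \<Longrightarrow>
      \<bar>norm_degree n A i - norm_degree n A j\<bar> > g"
    and "q \<in> {1..Q}"
  shows "C q = true_class n z q"
proof -
  from assms(1) obtain B \<tau> where "LG_output n Q A B" "\<tau> permutes {1..Q}"
    and C: "\<forall>q\<in>{1..Q}. C q = B (\<tau> q)"
    unfolding LG_classes_def by blast
  have "C ` {1..Q} = B ` \<tau> ` {1..Q}" using C by (auto simp: image_image)
  also have "\<dots> = B ` {1..Q}" using permutes_image[OF \<open>\<tau> permutes {1..Q}\<close>] by simp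
  also have "\<dots> = true_class n z ` {1..Q}"
    using LG_output_eq_partition[OF \<open>LG_output n Q A B\<close> assms(3-6)] .
  finally show ?thesis using assms(2,7) by (auto simp: labels_matched_def)
qed

section \<open>Exponential moments of Bernoulli sums\<close>

text \<open>This is Hoeffding's lemma for one Bernoulli variable. Negative \<open>l\<close> reduces
  to positive \<open>l\<close> by counting failures instead of successes: factoring out
  \<open>exp l\<close> replaces \<open>p\<close> by \<open>1 - p\<close> and \<open>l\<close> by
  \<open>- l\<close>.\<close>

lemma bernoulli_mgf_le:
  fixes p l :: real
  assumes "p \<in> {0..1}"
  shows "1 - p + p * exp l \<le> exp (l * p + l\<^sup>2 / 8)"
proof -
  have nonneg: "1 - p + p * exp l \<le> exp (l * p + l\<^sup>2 / 8)"
    if "p \<in> {0..1}" "l \<ge> 0" for p l :: real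
  proof -
    have "p * (exp l - 1) \<ge> 0" using that by simp
    then have pos: "1 + p * (exp l - 1) > 0" by linarith
    have "ln (1 + p * (exp l - 1)) \<le> l * p + l\<^sup>2 / 8"
      using Hoeffdings_lemma_aux[of l p] that by simp
    then have "1 + p * (exp l - 1) \<le> exp (l * p + l\<^sup>2 / 8)"
      using pos by (metis exp_le_cancel_iff exp_ln)
    then show ?thesis by (simp add: algebra_simps)
  qed
  show ?thesis
  proof (cases "l \<ge> 0")
    case False
    have "1 - p + p * exp l = exp l * (1 - (1 - p) + (1 - p) * exp (- l))"
      by (simp add: exp_minus field_simps)
    also have "\<dots> \<le> exp l * exp (- l * (1 - p) + (- l)\<^sup>2 / 8)"
      using assms False by (intro mult_left_mono nonneg) auto
    also have "\<dots> = exp (l * p + l\<^sup>2 / 8)"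
      by (simp add: exp_add [symmetric] algebra_simps)
    finally show ?thesis .
  qed (use nonneg assms in auto)
qed

text \<open>A bound on the hyperbolic cosine, read off from the fair coin: \<open>p = 1 / 2\<close>
  at parameter \<open>2 * x\<close>, recentred by \<open>exp (- x)\<close>.\<close>

lemma exp_add_exp_minus_le:
  fixes x :: real
  shows "exp x + exp (- x) \<le> 2 * exp (x\<^sup>2 / 2)"
proof -
  have "exp x + exp (- x) = 2 * exp (- x) * (1 - 1 / 2 + 1 / 2 * exp (2 * x))"
    by (simp add: algebra_simps flip: exp_add)
  also have "\<dots> \<le> 2 * exp (- x) * exp (2 * x * (1 / 2) + (2 * x)\<^sup>2 / 8)"
    by (intro mult_left_mono bernoulli_mgf_le) auto
  also have "\<dots> = 2 * exp (x\<^sup>2 / 2)"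
    by (simp add: power2_eq_square flip: exp_add)
  finally show ?thesis .
qed

text \<open>Integrates out the labels of all nodes other than \<open>i\<close>. Once the value at
  \<open>i\<close> is fixed, the remaining coordinates vary freely and the sum of products
  factorises.\<close>

lemma sum_PiE_split_coordinate:
  fixes h :: "'b \<Rightarrow> real" and G :: "'b \<Rightarrow> 'b \<Rightarrow> real"
  assumes "finite I" "finite S" "i \<in> I"
  shows "(\<Sum>z\<in>PiE I (\<lambda>_. S). h (z i) * (\<Prod>j\<in>I - {i}. G (z i) (z j))) =
         (\<Sum>q\<in>S. h q * (\<Sum>r\<in>S. G q r) ^ (card I - 1))"
proof -
  have "h q * (\<Sum>r\<in>S. G q r) ^ (card I - 1) =
      (\<Sum>z\<in>PiE I (\<lambda>_. S). if z i = q then h q * (\<Prod>j\<in>I - {i}. G q (z j)) else 0)"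
    if "q \<in> S" for q
  proof -
    \<comment> \<open>Coordinate \<open>i\<close> carries a point mass at \<open>q\<close>, so that
      one exchange of product and sum treats it like the others.\<close>
    define f where "f j x = (if j = i then if x = q then h q else 0 else G q x)" for j x
    have "h q * (\<Sum>r\<in>S. G q r) ^ (card I - 1) = (\<Prod>j\<in>I. \<Sum>x\<in>S. f j x)"
      using assms that by (subst prod.remove[OF assms(1,3)]) (simp add: f_def)
    also have "\<dots> = (\<Sum>z\<in>PiE I (\<lambda>_. S). \<Prod>j\<in>I. f j (z j))"
      using assms by (intro prod_sum_PiE) auto
    also have "\<dots> = (\<Sum>z\<in>PiE I (\<lambda>_. S).
        if z i = q then h q * (\<Prod>j\<in>I - {i}. G q (z j)) else 0)"
      by (intro sum.cong refl, subst prod.remove[OF assms(1,3)]) (simp add: f_def)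
    finally show ?thesis .
  qed
  then have "(\<Sum>q\<in>S. h q * (\<Sum>r\<in>S. G q r) ^ (card I - 1)) =
      (\<Sum>q\<in>S. \<Sum>z\<in>PiE I (\<lambda>_. S). if z i = q then h q * (\<Prod>j\<in>I - {i}. G q (z j)) else 0)"
    by (intro sum.cong) auto
  also have "\<dots> = (\<Sum>z\<in>PiE I (\<lambda>_. S). \<Sum>q\<in>S. if z i = q then h q * (\<Prod>j\<in>I - {i}. G q (z j)) else 0)"
    by (rule sum.swap)
  also have "\<dots> = (\<Sum>z\<in>PiE I (\<lambda>_. S). h (z i) * (\<Prod>j\<in>I - {i}. G (z i) (z j)))"
    using assms by (intro sum.cong refl) (auto simp: sum.delta' PiE_mem)
  finally show ?thesis ..
qed

context prob_space
begin

lemma expectation_bernoulli: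
  fixes Y :: "'a \<Rightarrow> bool" and f :: "bool \<Rightarrow> real"
  assumes [measurable]: "random_variable (count_space UNIV) Y"
    and p: "prob {\<omega> \<in> space M. Y \<omega>} = p"
  shows "expectation (\<lambda>\<omega>. f (Y \<omega>)) = (1 - p) * f False + p * f True"
proof -
  have [measurable]: "{\<omega> \<in> space M. Y \<omega>} \<in> events" by measurable
  have "expectation (\<lambda>\<omega>. f (Y \<omega>)) =
      expectation (\<lambda>\<omega>. f False + (f True - f False) * indicator {\<omega> \<in> space M. Y \<omega>} \<omega>)"
    by (intro Bochner_Integration.integral_cong) (auto split: split_indicator)
  also have "\<dots> = f False + (f True - f False) * p"
    using p
    by (subst Bochner_Integration.integral_add) (auto simp: prob_space emeasure_eq_measure)
  finally show ?thesis by (simp add: algebra_simps)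
qed

lemma expectation_exp_sum_bernoulli:
  fixes Y :: "'i \<Rightarrow> 'a \<Rightarrow> bool"
  assumes fin: "finite I" and indep: "indep_vars (\<lambda>_. count_space UNIV) Y I"
    and p: "\<And>i. i \<in> I \<Longrightarrow> prob {\<omega> \<in> space M. Y i \<omega>} = p i"
  shows "integrable M (\<lambda>\<omega>. exp (l * (\<Sum>i\<in>I. of_bool (Y i \<omega>))))"
    and "expectation (\<lambda>\<omega>. exp (l * (\<Sum>i\<in>I. of_bool (Y i \<omega>)))) = (\<Prod>i\<in>I. 1 - p i + p i * exp l)"
proof -
  define f where "f b = exp (l * of_bool b)" for b
  have rv: "random_variable (count_space UNIV) (Y i)" if "i \<in> I" for i
    using indep that by (auto simp: indep_vars_def)
  have indep_f: "indep_vars (\<lambda>_. borel) (\<lambda>i \<omega>. f (Y i \<omega>)) I"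
    by (intro indep_vars_compose2[OF indep]) auto
  have int: "integrable M (\<lambda>\<omega>. f (Y i \<omega>))" if "i \<in> I" for i
    using rv[OF that]
    by (intro integrable_const_bound[where B = "max (f False) (f True)"])
       (auto simp: f_def max_def split: bool.splits)
  have eq: "exp (l * (\<Sum>i\<in>I. of_bool (Y i \<omega>))) = (\<Prod>i\<in>I. f (Y i \<omega>))" for \<omega>
    unfolding f_def sum_distrib_left by (rule exp_sum[OF fin])
  show "integrable M (\<lambda>\<omega>. exp (l * (\<Sum>i\<in>I. of_bool (Y i \<omega>))))"
    unfolding eq using fin indep_f int by (rule indep_vars_integrable)
  have "expectation (\<lambda>\<omega>. exp (l * (\<Sum>i\<in>I. of_bool (Y i \<omega>)))) = (\<Prod>i\<in>I. expectation (\<lambda>\<omega>. f (Y i \<omega>)))"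
    unfolding eq using fin indep_f int by (rule indep_vars_lebesgue_integral)
  also have "\<dots> = (\<Prod>i\<in>I. 1 - p i + p i * exp l)"
    using expectation_bernoulli[OF rv p, where f = f] by (intro prod.cong) (auto simp: f_def)
  finally show "expectation (\<lambda>\<omega>. exp (l * (\<Sum>i\<in>I. of_bool (Y i \<omega>)))) = (\<Prod>i\<in>I. 1 - p i + p i * exp l)" .
qed

lemma bernoulli_Hoeffding:
  fixes Y :: "'i \<Rightarrow> 'a \<Rightarrow> bool" and p t :: real
  assumes fin: "finite I" and indep: "indep_vars (\<lambda>_. count_space UNIV) Y I"
    and p: "\<And>i. i \<in> I \<Longrightarrow> prob {\<omega> \<in> space M. Y i \<omega>} = p" and "t \<ge> 0"
  shows bernoulli_Hoeffding_abs:
      "prob {\<omega> \<in> space M. \<bar>(\<Sum>i\<in>I. of_bool (Y i \<omega>)) - card I * p\<bar> \<ge> card I * t}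
        \<le> 2 * exp (- 2 * real (card I) * t\<^sup>2)" (is "?abs")
    and bernoulli_Hoeffding_le:
      "prob {\<omega> \<in> space M. (\<Sum>i\<in>I. of_bool (Y i \<omega>)) \<le> card I * p - card I * t}
        \<le> exp (- 2 * real (card I) * t\<^sup>2)" (is "?le")
proof -
  have "?abs \<and> ?le"
  proof (cases "I = {}")
    \<comment> \<open>Both right-hand sides are at least 1 here. The case has to be covered because
      a pair of classes may have no edge positions, while the general inequality divides by the sum
      of squared ranges.\<close>
    case True
    then show ?thesis by (auto intro: order_trans[OF prob_le_1])
  next
    case False
    then have "card I > 0" using fin by (simp add: card_gt_0_iff)
    have rv: "random_variable (count_space UNIV) (Y i)" if "i \<in> I" for i
      using indep that by (auto simp: indep_vars_def)
    have mean: "expectation (\<lambda>\<omega>. of_bool (Y i \<omega>)) = p" if "i \<in> I" for i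
      using expectation_bernoulli[OF rv p, OF that that, of of_bool] by simp
    interpret Hoeffding_ineq M I "\<lambda>i \<omega>. of_bool (Y i \<omega>)" "\<lambda>_. 0" "\<lambda>_. 1" "card I * p"
      by unfold_locales (use fin mean in \<open>auto intro!: indep_vars_compose2[OF indep]\<close>)
    have eq: "- 2 * (real (card I) * t)\<^sup>2 / (\<Sum>i\<in>I. (1 - 0)\<^sup>2) = - 2 * real (card I) * t\<^sup>2"
      using \<open>card I > 0\<close> by (simp add: power2_eq_square)
    have nonneg: "real (card I) * t \<ge> 0" and pos: "(\<Sum>i\<in>I. (1 - 0 :: real)\<^sup>2) > 0"
      using \<open>t \<ge> 0\<close> \<open>card I > 0\<close> by auto
    show ?thesis
      using Hoeffding_ineq_abs_ge[OF nonneg pos] Hoeffding_ineq_le[OF nonneg pos]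
      unfolding eq by blast
  qed
  then show ?abs ?le by auto
qed

text \<open>Both tails go through one application of Markov's inequality, to the sum of the two
  exponentials. Keeping the sum intact lets opposite biases of the tails be combined afterwards
  instead of being bounded one at a time.\<close>

lemma prob_abs_diff_ge_Chernoff:
  fixes S :: "'a \<Rightarrow> real" and c l \<epsilon> :: real
  assumes [measurable]: "random_variable borel S" and l: "l > 0"
    and int: "integrable M (\<lambda>\<omega>. exp (l * S \<omega>))" "integrable M (\<lambda>\<omega>. exp (- l * S \<omega>))"
  shows "prob {\<omega> \<in> space M. \<bar>S \<omega> - c\<bar> \<ge> \<epsilon>} \<le> exp (- l * \<epsilon>) *
    (exp (- l * c) * expectation (\<lambda>\<omega>. exp (l * S \<omega>)) + exp (l * c) * expectation (\<lambda>\<omega>. exp (- l * S \<omega>)))"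
proof -
  define f where "f \<omega> = exp (- l * c) * exp (l * S \<omega>) + exp (l * c) * exp (- l * S \<omega>)" for \<omega>
  have int_f: "integrable M f" unfolding f_def using int by auto
  have "prob {\<omega> \<in> space M. \<bar>S \<omega> - c\<bar> \<ge> \<epsilon>} \<le> prob {\<omega> \<in> space M. f \<omega> \<ge> exp (l * \<epsilon>)}"
  proof (intro finite_measure_mono subsetI)
    fix \<omega> assume "\<omega> \<in> {\<omega> \<in> space M. \<bar>S \<omega> - c\<bar> \<ge> \<epsilon>}"
    then have \<omega>: "\<omega> \<in> space M" and "S \<omega> - c \<ge> \<epsilon> \<or> c - S \<omega> \<ge> \<epsilon>" by auto
    then have "l * \<epsilon> \<le> l * (S \<omega> - c) \<or> l * \<epsilon> \<le> l * (c - S \<omega>)" using l by auto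
    then have "exp (l * \<epsilon>) \<le> exp (l * (S \<omega> - c)) \<or> exp (l * \<epsilon>) \<le> exp (l * (c - S \<omega>))"
      by simp
    moreover have "f \<omega> = exp (l * (S \<omega> - c)) + exp (l * (c - S \<omega>))"
      by (simp add: f_def algebra_simps flip: exp_add)
    ultimately have "exp (l * \<epsilon>) \<le> f \<omega>"
      using exp_ge_zero[of "l * (S \<omega> - c)"] exp_ge_zero[of "l * (c - S \<omega>)"] by linarith
    then show "\<omega> \<in> {\<omega> \<in> space M. f \<omega> \<ge> exp (l * \<epsilon>)}" using \<omega> by simp
  next
    show "{\<omega> \<in> space M. f \<omega> \<ge> exp (l * \<epsilon>)} \<in> events" unfolding f_def by measurable
  qed
  also have "\<dots> \<le> expectation f / exp (l * \<epsilon>)"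
    by (intro integral_Markov_inequality_measure[OF int_f, where A = "{}"]) (auto simp: f_def)
  also have "expectation f = exp (- l * c) * expectation (\<lambda>\<omega>. exp (l * S \<omega>)) +
      exp (l * c) * expectation (\<lambda>\<omega>. exp (- l * S \<omega>))"
    unfolding f_def using int by simp
  finally show ?thesis by (simp add: exp_minus divide_simps mult_ac)
qed

end

section \<open>Edges between two classes\<close>

text \<open>Pairs are stored in increasing order because the conditional independence is assumed for
  those indices. The condition is symmetric in \<open>q\<close> and \<open>r\<close> since the
  smaller node may lie in either class.\<close>

definition class_edges :: "nat \<Rightarrow> (nat \<Rightarrow> nat) \<Rightarrow> nat \<Rightarrow> nat \<Rightarrow> (nat \<times> nat) set" where
  "class_edges n z q r =
    {(i, j). 1 \<le> i \<and> i < j \<and> j \<le> n \<and> (z i = q \<and> z j = r \<or> z i = r \<and> z j = q)}"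

lemma class_edges_subset: "class_edges n z q r \<subseteq> {(i, j). 1 \<le> i \<and> i < j \<and> j \<le> n}"
  by (auto simp: class_edges_def)

lemma finite_class_edges: "finite (class_edges n z q r)"
  by (rule finite_subset[of _ "{1..n} \<times> {1..n}"]) (auto simp: class_edges_def)

text \<open>Sorting a pair loses nothing here: distinct labels reveal which entry came from which
  class. For equal labels both orders of a pair would collapse, hence the separate diagonal count
  below.\<close>

lemma bij_betw_unordered_pair:
  assumes "q \<noteq> r"
  shows "bij_betw (\<lambda>(i, j). (min i j, max i j)) (true_class n z q \<times> true_class n z r)
    (class_edges n z q r)"
proof (rule bij_betwI')
  fix x y assume "x \<in> true_class n z q \<times> true_class n z r" "y \<in> true_class n z q \<times> true_class n z r"
  moreover obtain i j where x: "x = (i, j)" by (cases x)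
  moreover obtain i' j' where y: "y = (i', j')" by (cases y)
  ultimately have z: "z i = q" "z j = r" "z i' = q" "z j' = r"
    by (simp_all add: true_class_def)
  have "min i j = min i' j' \<Longrightarrow> max i j = max i' j' \<Longrightarrow> i = i' \<and> j = j' \<or> i = j' \<and> j = i'"
    by (cases "i \<le> j"; cases "i' \<le> j'") (simp_all add: min_def max_def)
  then show "((case x of (i, j) \<Rightarrow> (min i j, max i j)) = (case y of (i, j) \<Rightarrow> (min i j, max i j))) = (x = y)"
    using z assms x y by auto
next
  fix x assume "x \<in> true_class n z q \<times> true_class n z r"
  then obtain i j where x: "x = (i, j)" "i \<in> {1..n}" "j \<in> {1..n}" "z i = q" "z j = r"
    by (auto simp: true_class_def)
  then have "i \<noteq> j" using assms by auto
  then show "(case x of (i, j) \<Rightarrow> (min i j, max i j)) \<in> class_edges n z q r"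
    using x by (auto simp: class_edges_def min_def max_def)
next
  fix y assume y: "y \<in> class_edges n z q r"
  then obtain i j where ij: "y = (i, j)" "i \<in> {1..n}" "j \<in> {1..n}" "i < j"
    and "z i = q \<and> z j = r \<or> z i = r \<and> z j = q"
    by (auto simp: class_edges_def)
  then consider "z i = q" "z j = r" | "z i = r" "z j = q" by blast
  then show "\<exists>x\<in>true_class n z q \<times> true_class n z r. y = (case x of (i, j) \<Rightarrow> (min i j, max i j))"
  proof cases
    case 1
    then show ?thesis using ij by (intro bexI[of _ "(i, j)"]) (auto simp: true_class_def)
  next
    case 2
    then show ?thesis using ij by (intro bexI[of _ "(j, i)"]) (auto simp: true_class_def)
  qed
qed

text \<open>The count is doubled to match the exponent \<open>- 2 * card * t\<^sup>2\<close> of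
  Hoeffding's inequality. On the diagonal, the square of the class splits into the increasing pairs,
  their mirror images and the pairs \<open>(i, i)\<close>.\<close>

lemma card_class_edges:
  "2 * real (card (class_edges n z q r)) =
    (if q = r then real (card (true_class n z q)) * (real (card (true_class n z q)) - 1)
     else 2 * (real (card (true_class n z q)) * real (card (true_class n z r))))"
proof (cases "q = r")
  case False
  have "real (card (class_edges n z q r)) = real (card (true_class n z q)) * real (card (true_class n z r))"
    using bij_betw_same_card[OF bij_betw_unordered_pair[OF False, of n z]]
    by (simp add: card_cartesian_product flip: of_nat_mult)
  then show ?thesis using False by simp
next
  case True
  let ?S = "true_class n z q" and ?E = "class_edges n z q q"
  have fin: "finite ?S" "finite ?E" by (simp_all add: true_class_def finite_class_edges)
  have less: "i < j" if "(i, j) \<in> ?E" for i j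
    using that by (simp add: class_edges_def)
  have "?S \<times> ?S = ?E \<union> prod.swap ` ?E \<union> (\<lambda>i. (i, i)) ` ?S"
  proof (intro equalityI subsetI)
    fix x assume "x \<in> ?S \<times> ?S"
    then obtain i j where x: "x = (i, j)" "i \<in> ?S" "j \<in> ?S" by blast
    then consider "(i, j) \<in> ?E" | "(j, i) \<in> ?E" | "i = j"
      by (cases i j rule: linorder_cases) (auto simp: class_edges_def true_class_def)
    then show "x \<in> ?E \<union> prod.swap ` ?E \<union> (\<lambda>i. (i, i)) ` ?S"
      using x by cases (auto intro: image_eqI[of _ prod.swap "(j, i)"])
  qed (auto simp: class_edges_def true_class_def)
  moreover have "?E \<inter> prod.swap ` ?E = {}" "(?E \<union> prod.swap ` ?E) \<inter> (\<lambda>i. (i, i)) ` ?S = {}"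
    by (auto dest!: less)
  ultimately have "card (?S \<times> ?S) = card ?E + card (prod.swap ` ?E) + card ((\<lambda>i. (i, i)) ` ?S)"
    using fin by (simp add: card_Un_disjoint)
  also have "\<dots> = 2 * card ?E + card ?S"
    by (subst (1 2) card_image) (auto simp: inj_on_def)
  finally have "real (card ?S) * real (card ?S) = 2 * real (card ?E) + real (card ?S)"
    by (simp add: card_cartesian_product flip: of_nat_mult)
  then show ?thesis using True by (simp add: algebra_simps)
qed

text \<open>A nonempty set of pairs makes the relevant denominator nonzero, so the default
  \<open>v\<close> does not enter. Off the diagonal, symmetry of \<open>A\<close> allows each pair
  to be sorted.\<close>

lemma pi_hat_eq_mean:
  assumes sym: "\<And>i j. i \<in> {1..n} \<Longrightarrow> j \<in> {1..n} \<Longrightarrow> A i j = A j i"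
    and pos: "class_edges n z q r \<noteq> {}"
  shows "pi_hat v A (true_class n z) q r =
    (\<Sum>(i, j)\<in>class_edges n z q r. of_bool (A i j)) / card (class_edges n z q r)"
proof -
  let ?E = "class_edges n z q r"
  have card: "real (card ?E) > 0" using pos finite_class_edges by (simp add: card_gt_0_iff)
  show ?thesis
  proof (cases "q = r")
    case True
    have "{(i, j). i \<in> true_class n z q \<and> j \<in> true_class n z q \<and> i < j} = ?E"
      using True by (auto simp: class_edges_def true_class_def)
    moreover have "real (card (true_class n z q)) * (real (card (true_class n z q)) - 1) = 2 * real (card ?E)"
      using card_class_edges[of n z q r] True by simp
    moreover from this card have "real (card (true_class n z q)) * (real (card (true_class n z q)) - 1) \<noteq> 0"
      by simp
    ultimately show ?thesis using True card by (simp only: pi_hat_def Let_def if_True if_False) simp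
  next
    case False
    have "(\<Sum>(i, j)\<in>?E. of_bool (A i j) :: real) =
      (\<Sum>x\<in>true_class n z q \<times> true_class n z r.
        case (case x of (i, j) \<Rightarrow> (min i j, max i j)) of (i, j) \<Rightarrow> of_bool (A i j))"
      by (rule sum.reindex_bij_betw[OF bij_betw_unordered_pair[OF False], symmetric])
    also have "\<dots> = (\<Sum>(i, j)\<in>true_class n z q \<times> true_class n z r. of_bool (A i j))"
      using sym by (intro sum.cong refl) (auto simp: true_class_def min_def max_def split: prod.splits)
    finally have "(\<Sum>(i, j)\<in>true_class n z q \<times> true_class n z r. of_bool (A i j) :: real) =
      (\<Sum>(i, j)\<in>?E. of_bool (A i j))" ..
    moreover have "real (card (true_class n z q)) * real (card (true_class n z r)) = real (card ?E)"
      using card_class_edges[of n z q r] False by simp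
    moreover from this card have "real (card (true_class n z q)) * real (card (true_class n z r)) \<noteq> 0"
      by simp
    ultimately show ?thesis using False card by (simp only: pi_hat_def Let_def if_True if_False) simp
  qed
qed

lemma bij_betw_incident_pair:
  fixes i n :: nat
  assumes "i \<in> {1..n}"
  shows "bij_betw (\<lambda>j. (min i j, max i j)) ({1..n} - {i})
    {(a, b). 1 \<le> a \<and> a < b \<and> b \<le> n \<and> (a = i \<or> b = i)}"
  by (rule bij_betw_byWitness[where f' = "\<lambda>(a, b). if a = i then b else a"])
    (use assms in \<open>auto simp: min_def max_def split: if_splits\<close>)

section \<open>Deviations in the block model\<close>

locale sbm_params = sbm +
  assumes Q_pos: "Q \<ge> 1" and n_pos: "n \<ge> 1"
    and alpha_nonneg: "\<And>q. q \<in> {1..Q} \<Longrightarrow> \<alpha> q \<ge> 0"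
    and alpha_sum: "(\<Sum>q\<in>{1..Q}. \<alpha> q) = 1"
    and pi_sym: "\<And>q r. q \<in> {1..Q} \<Longrightarrow> r \<in> {1..Q} \<Longrightarrow> \<pi> q r = \<pi> r q"
    and pi_range: "\<And>q r. q \<in> {1..Q} \<Longrightarrow> r \<in> {1..Q} \<Longrightarrow> \<pi> q r \<in> {0..1}"
begin

section \<open>Conditioning on the labels\<close>

text \<open>Extensionality makes two distinct labelings differ at some node, so their label events
  are disjoint and the set is finite.\<close>

definition labelings :: "(nat \<Rightarrow> nat) set" where
  "labelings = PiE {1..n} (\<lambda>_. {1..Q})"

definition label_event :: "(nat \<Rightarrow> nat) \<Rightarrow> 'a set" where
  "label_event z = {\<omega> \<in> space M. \<forall>i\<in>{1..n}. Z i \<omega> = z i}"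

lemma finite_labelings: "finite labelings"
  unfolding labelings_def by (intro finite_PiE) auto

lemma labelings_range: "z \<in> labelings \<Longrightarrow> i \<in> {1..n} \<Longrightarrow> z i \<in> {1..Q}"
  unfolding labelings_def by (rule PiE_mem)

lemma labels_rv: "i \<in> {1..n} \<Longrightarrow> random_variable (count_space UNIV) (Z i)"
  using labels_indep by (simp add: indep_vars_def)

lemma prob_labels_in:
  "prob {\<omega> \<in> space M. \<forall>i\<in>{1..n}. Z i \<omega> \<in> S i} =
    (\<Prod>i\<in>{1..n}. prob {\<omega> \<in> space M. Z i \<omega> \<in> S i})"
proof -
  have "{\<omega> \<in> space M. \<forall>i\<in>{1..n}. Z i \<omega> \<in> S i} = (\<Inter>i\<in>{1..n}. Z i -` S i \<inter> space M)"
    using n_pos by auto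
  also have "prob \<dots> = (\<Prod>i\<in>{1..n}. prob (Z i -` S i \<inter> space M))"
    using n_pos by (intro indep_varsD_finite[OF labels_indep]) auto
  also have "\<dots> = (\<Prod>i\<in>{1..n}. prob {\<omega> \<in> space M. Z i \<omega> \<in> S i})"
    by (intro prod.cong refl arg_cong[where f = prob]) auto
  finally show ?thesis .
qed

lemma prob_label_event: "z \<in> labelings \<Longrightarrow> prob (label_event z) = (\<Prod>i\<in>{1..n}. \<alpha> (z i))"
  using prob_labels_in[of "\<lambda>i. {z i}"] labels_prob labelings_range
  by (simp add: label_event_def)

lemma label_event_sets: "label_event z \<in> events"
proof -
  have "label_event z = (\<Inter>i\<in>{1..n}. Z i -` {z i} \<inter> space M)"
    using n_pos by (auto simp: label_event_def)
  also have "\<dots> \<in> events"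
    using n_pos by (intro sets.finite_INT measurable_sets[OF labels_rv]) auto
  finally show ?thesis .
qed

lemma restrict_labels_in_labelings:
  assumes "\<omega> \<in> space M"
  shows "restrict (\<lambda>i. Z i \<omega>) {1..n} \<in> labelings" "\<omega> \<in> label_event (restrict (\<lambda>i. Z i \<omega>) {1..n})"
  using assms labels_range by (auto simp: labelings_def label_event_def)

lemma sum_prob_label_event:
  "(\<Sum>z | z \<in> labelings \<and> P z. prob (label_event z)) = prob (\<Union>z\<in>{z \<in> labelings. P z}. label_event z)"
proof (rule finite_measure_finite_Union[symmetric])
  show "disjoint_family_on label_event {z \<in> labelings. P z}"
  proof (unfold disjoint_family_on_def, intro ballI impI equals0I)
    fix y z \<omega> assume yz: "y \<in> {z \<in> labelings. P z}" "z \<in> {z \<in> labelings. P z}" "y \<noteq> z"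
      and "\<omega> \<in> label_event y \<inter> label_event z"
    then have "\<forall>i\<in>{1..n}. y i = z i" by (auto simp: label_event_def)
    then have "y = z"
      using PiE_ext[of y "{1..n}" "\<lambda>_. {1..Q}" z] yz by (simp add: labelings_def)
    then show False using yz by simp
  qed
qed (use finite_labelings label_event_sets in auto)

lemma sum_prob_label_event_1: "(\<Sum>z\<in>labelings. prob (label_event z)) = 1"
proof -
  have "(\<Union>z\<in>labelings. label_event z) = space M"
    using restrict_labels_in_labelings by (fastforce simp: label_event_def)
  then show ?thesis using sum_prob_label_event[of "\<lambda>_. True"] prob_space by simp
qed

text \<open>Total probability as an upper bound. The conditional measure is meaningful only for
  labelings of positive probability; null labelings contribute 0 to both sides.\<close>

lemma prob_UN_label_event_le:
  assumes K: "\<And>z. z \<in> labelings \<Longrightarrow> K z \<in> events"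
    and f: "\<And>z. z \<in> labelings \<Longrightarrow> prob (label_event z) > 0 \<Longrightarrow>
      measure (uniform_measure M (label_event z)) (K z) \<le> f z"
  shows "prob (\<Union>z\<in>labelings. label_event z \<inter> K z) \<le> (\<Sum>z\<in>labelings. prob (label_event z) * f z)"
proof -
  have "prob (\<Union>z\<in>labelings. label_event z \<inter> K z) \<le> (\<Sum>z\<in>labelings. prob (label_event z \<inter> K z))"
    using K label_event_sets by (intro measure_UNION_le finite_labelings) auto
  also have "\<dots> \<le> (\<Sum>z\<in>labelings. prob (label_event z) * f z)"
  proof (rule sum_mono)
    fix z assume z: "z \<in> labelings"
    show "prob (label_event z \<inter> K z) \<le> prob (label_event z) * f z"
    proof (cases "prob (label_event z) > 0")
      case True
      have "prob (label_event z \<inter> K z) =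
          prob (label_event z) * measure (uniform_measure M (label_event z)) (K z)"
        using True K[OF z] by (subst measure_uniform_measure) (auto simp: emeasure_eq_measure)
      then show ?thesis using f[OF z True] True by simp
    next
      case False
      then have "prob (label_event z) = 0" by (simp add: zero_less_measure_iff)
      moreover have "prob (label_event z \<inter> K z) \<le> prob (label_event z)"
        by (intro finite_measure_mono label_event_sets) auto
      ultimately show ?thesis by simp
    qed
  qed
  finally show ?thesis .
qed

lemma prob_space_cond: "prob (label_event z) > 0 \<Longrightarrow> prob_space (uniform_measure M (label_event z))"
  by (intro prob_space_uniform_measure) (auto simp: emeasure_eq_measure)

lemma cond_indep:
  assumes "prob (label_event z) > 0"
  shows "prob_space.indep_vars (uniform_measure M (label_event z))
    (\<lambda>_. count_space UNIV) (\<lambda>(i, j). X i j) {(i, j). 1 \<le> i \<and> i < j \<and> j \<le> n}"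
  using edges_cond_indep assms unfolding label_event_def by blast

lemma cond_edge_prob:
  assumes z: "z \<in> labelings" and pos: "prob (label_event z) > 0"
    and ij: "1 \<le> i" "i < j" "j \<le> n"
  shows "measure (uniform_measure M (label_event z)) {\<omega> \<in> space M. X i j \<omega>} = \<pi> (z i) (z j)"
proof -
  let ?N = "uniform_measure M (label_event z)"
  have [measurable]: "X i j \<in> measurable ?N (count_space UNIV)"
    using edges_rv[of i j] ij by (simp add: measurable_def)
  have "{\<omega> \<in> space M. X i j \<omega>} = X i j -` {True} \<inter> space ?N" by auto
  then have "measure ?N {\<omega> \<in> space M. X i j \<omega>} = measure (distr ?N (count_space UNIV) (X i j)) {True}"
    by (subst measure_distr) auto
  also have "\<dots> = pmf (bernoulli_pmf (\<pi> (z i) (z j))) True"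
    using edges_cond_bernoulli[of z i j] pos ij unfolding label_event_def
    by (simp add: measure_pmf_single)
  also have "\<dots> = \<pi> (z i) (z j)"
    using pi_range[of "z i" "z j"] labelings_range[OF z] ij by auto
  finally show ?thesis .
qed

lemma random_edge: "i \<in> {1..n} \<Longrightarrow> j \<in> {1..n} \<Longrightarrow> (\<lambda>\<omega>. of_bool (X i j \<omega>) :: real) \<in> borel_measurable M"
  using measurable_compose[OF edges_rv, of i j of_bool borel] by simp

section \<open>Class sizes\<close>

lemma class_size_eq_sum:
  "real (card (true_class n z q)) = (\<Sum>i\<in>{1..n}. of_bool (z i = q))"
  by (simp add: true_class_def of_bool_def sum.If_cases Int_def)

lemma class_size_measurable:
  "(\<lambda>\<omega>. \<Sum>i\<in>{1..n}. of_bool (Z i \<omega> = q) :: real) \<in> borel_measurable M"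
proof (rule borel_measurable_sum)
  fix i assume "i \<in> {1..n}"
  then show "(\<lambda>\<omega>. of_bool (Z i \<omega> = q) :: real) \<in> borel_measurable M"
    using measurable_compose[OF labels_rv, of i "\<lambda>k. of_bool (k = q)" borel] by simp
qed

lemma class_size_deviation:
  fixes t :: real
  assumes q: "q \<in> {1..Q}" and "t \<ge> 0"
  shows class_size_deviation_abs:
      "prob {\<omega> \<in> space M. \<bar>(\<Sum>i\<in>{1..n}. of_bool (Z i \<omega> = q)) - n * \<alpha> q\<bar> \<ge> n * t}
        \<le> 2 * exp (- 2 * real n * t\<^sup>2)" (is ?abs)
    and class_size_deviation_le:
      "prob {\<omega> \<in> space M. (\<Sum>i\<in>{1..n}. of_bool (Z i \<omega> = q)) \<le> n * \<alpha> q - n * t}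
        \<le> exp (- 2 * real n * t\<^sup>2)" (is ?le)
proof -
  have "indep_vars (\<lambda>_. count_space UNIV) (\<lambda>i \<omega>. Z i \<omega> = q) {1..n}"
    by (rule indep_vars_compose2[OF labels_indep]) auto
  then show ?abs ?le
    using bernoulli_Hoeffding[of "{1..n}" "\<lambda>i \<omega>. Z i \<omega> = q" "\<alpha> q" t] labels_prob q \<open>t \<ge> 0\<close>
    by simp_all
qed

lemma prob_class_empty:
  assumes q: "q \<in> {1..Q}"
  shows "prob {\<omega> \<in> space M. \<forall>i\<in>{1..n}. Z i \<omega> \<noteq> q} = (1 - \<alpha> q) ^ n"
proof -
  have "prob {\<omega> \<in> space M. Z i \<omega> \<noteq> q} = 1 - \<alpha> q" if i: "i \<in> {1..n}" for i
  proof -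
    have [measurable]: "random_variable (count_space UNIV) (Z i)" using labels_rv i by blast
    show ?thesis using prob_neg[of "\<lambda>\<omega>. Z i \<omega> = q"] labels_prob[OF i q] by simp
  qed
  then show ?thesis using prob_labels_in[of "\<lambda>_. - {q}"] by simp
qed

section \<open>Edge densities\<close>

definition edge_sum :: "(nat \<Rightarrow> nat) \<Rightarrow> nat \<Rightarrow> nat \<Rightarrow> 'a \<Rightarrow> real" where
  "edge_sum z q r \<omega> = (\<Sum>(i, j)\<in>class_edges n z q r. of_bool (X i j \<omega>))"

text \<open>Deviation events are unions over all labelings, so that their measurability does not involve
  the estimators.\<close>

definition edge_deviation :: "real \<Rightarrow> nat \<Rightarrow> nat \<Rightarrow> 'a set" where
  "edge_deviation t q r = (\<Union>z\<in>labelings. label_event z \<inter>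
    {\<omega> \<in> space M. \<bar>edge_sum z q r \<omega> - card (class_edges n z q r) * \<pi> q r\<bar>
      \<ge> real (card (class_edges n z q r)) * t})"

lemma edge_sum_measurable: "edge_sum z q r \<in> borel_measurable M"
proof -
  have "(\<lambda>\<omega>. (case e of (i, j) \<Rightarrow> of_bool (X i j \<omega>)) :: real) \<in> borel_measurable M"
    if "e \<in> class_edges n z q r" for e
    using that random_edge by (cases e) (auto simp: class_edges_def)
  then show ?thesis unfolding edge_sum_def by (rule borel_measurable_sum)
qed

lemma edge_deviation_sets: "edge_deviation t q r \<in> events"
proof -
  note edge_sum_measurable[measurable]
  show ?thesis
    unfolding edge_deviation_def
    by (intro sets.finite_UN finite_labelings sets.Int label_event_sets) measurable
qed

text \<open>\<open>W\<close> is a lower bound for the doubled number of pairs that holds as long as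
  neither class is too small. For the other labelings the conditional probability is bounded by the
  indicators \<open>small\<close>, whose average over labelings is a lower tail of a class
  size.\<close>

lemma prob_edge_deviation:
  fixes s t W :: real
  assumes q: "q \<in> {1..Q}" and r: "r \<in> {1..Q}" and "t \<ge> 0" "s \<ge> 0"
    and W: "\<And>z. z \<in> labelings \<Longrightarrow>
      real (card (true_class n z q)) > n * \<alpha> q - n * s \<Longrightarrow>
      real (card (true_class n z r)) > n * \<alpha> r - n * s \<Longrightarrow>
      W \<le> 2 * real (card (class_edges n z q r))"
  shows "prob (edge_deviation t q r) \<le> 2 * exp (- W * t\<^sup>2) + 4 * exp (- 2 * real n * s\<^sup>2)"
proof -
  define K where "K z = {\<omega> \<in> space M. \<bar>edge_sum z q r \<omega> - card (class_edges n z q r) * \<pi> q r\<bar>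
    \<ge> real (card (class_edges n z q r)) * t}" for z
  define small where "small z u \<longleftrightarrow> real (card (true_class n z u)) \<le> n * \<alpha> u - n * s" for z u
  have small: "(\<Sum>z\<in>labelings. prob (label_event z) * of_bool (small z u)) \<le> exp (- 2 * real n * s\<^sup>2)"
    if u: "u \<in> {1..Q}" for u
  proof -
    have "(\<Sum>z\<in>labelings. prob (label_event z) * of_bool (small z u)) =
        (\<Sum>z | z \<in> labelings \<and> small z u. prob (label_event z))"
      by (rule sum.mono_neutral_cong_right) (use finite_labelings in auto)
    also have "\<dots> = prob (\<Union>z\<in>{z \<in> labelings. small z u}. label_event z)"
      by (rule sum_prob_label_event)
    also have "\<dots> \<le> prob {\<omega> \<in> space M. (\<Sum>i\<in>{1..n}. of_bool (Z i \<omega> = u)) \<le> n * \<alpha> u - n * s}"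
    proof (rule finite_measure_mono)
      note class_size_measurable[measurable]
      show "{\<omega> \<in> space M. (\<Sum>i\<in>{1..n}. of_bool (Z i \<omega> = u)) \<le> n * \<alpha> u - n * s} \<in> events"
        by measurable
    qed (auto simp: small_def label_event_def class_size_eq_sum simp del: sum_of_bool_eq)
    also have "\<dots> \<le> exp (- 2 * real n * s\<^sup>2)" by (rule class_size_deviation_le[OF u \<open>s \<ge> 0\<close>])
    finally show ?thesis .
  qed
  have "prob (\<Union>z\<in>labelings. label_event z \<inter> K z) \<le> (\<Sum>z\<in>labelings. prob (label_event z) *
      (2 * exp (- W * t\<^sup>2) + 2 * of_bool (small z q) + 2 * of_bool (small z r)))"
  proof (rule prob_UN_label_event_le)
    fix z assume z: "z \<in> labelings"
    note edge_sum_measurable[measurable]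
    show "K z \<in> events" unfolding K_def by measurable
    assume pos: "prob (label_event z) > 0"
    let ?N = "uniform_measure M (label_event z)" and ?E = "class_edges n z q r"
    interpret N: prob_space ?N by (rule prob_space_cond[OF pos])
    show "measure ?N (K z) \<le> 2 * exp (- W * t\<^sup>2) + 2 * of_bool (small z q) + 2 * of_bool (small z r)"
    proof (cases "small z q \<or> small z r")
      case True
      have "measure ?N (K z) \<le> 1" by (rule N.prob_le_1)
      also have "1 \<le> of_bool (small z q) + (of_bool (small z r) :: real)" using True by auto
      also have "\<dots> \<le> 2 * exp (- W * t\<^sup>2) + 2 * of_bool (small z q) + 2 * of_bool (small z r)"
        by simp
      finally show ?thesis .
    next
      case False
      have "measure ?N {\<omega> \<in> space ?N. \<bar>(\<Sum>e\<in>?E. of_bool ((case e of (i, j) \<Rightarrow> X i j) \<omega>)) - card ?E * \<pi> q r\<bar> \<ge> card ?E * t}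
          \<le> 2 * exp (- 2 * real (card ?E) * t\<^sup>2)"
      proof (rule N.bernoulli_Hoeffding_abs)
        show "N.indep_vars (\<lambda>_. count_space UNIV) (\<lambda>(i, j). X i j) ?E"
          using cond_indep[OF pos] class_edges_subset by (rule N.indep_vars_subset)
        fix e assume "e \<in> ?E"
        then obtain i j where e: "e = (i, j)" "1 \<le> i" "i < j" "j \<le> n"
          and "z i = q \<and> z j = r \<or> z i = r \<and> z j = q" by (auto simp: class_edges_def)
        then have "\<pi> (z i) (z j) = \<pi> q r" using pi_sym q r by metis
        then show "measure ?N {\<omega> \<in> space ?N. (case e of (i, j) \<Rightarrow> X i j) \<omega>} = \<pi> q r"
          using cond_edge_prob[OF z pos, of i j] e by simp
      qed (use finite_class_edges \<open>t \<ge> 0\<close> in auto)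
      also have "{\<omega> \<in> space ?N. \<bar>(\<Sum>e\<in>?E. of_bool ((case e of (i, j) \<Rightarrow> X i j) \<omega>)) - card ?E * \<pi> q r\<bar> \<ge> card ?E * t} = K z"
        unfolding K_def edge_sum_def by (simp add: case_prod_beta)
      also have "2 * exp (- 2 * real (card ?E) * t\<^sup>2) \<le> 2 * exp (- W * t\<^sup>2)"
        using mult_right_mono[OF W[OF z], of "t\<^sup>2"] False by (simp add: small_def not_le)
      finally show ?thesis using False by simp
    qed
  qed
  also have "\<dots> = 2 * exp (- W * t\<^sup>2) * (\<Sum>z\<in>labelings. prob (label_event z)) +
      2 * (\<Sum>z\<in>labelings. prob (label_event z) * of_bool (small z q)) +
      2 * (\<Sum>z\<in>labelings. prob (label_event z) * of_bool (small z r))"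
    unfolding sum_distrib_left sum.distrib[symmetric]
    by (intro sum.cong) (simp_all add: algebra_simps)
  also have "\<dots> \<le> 2 * exp (- W * t\<^sup>2) + 4 * exp (- 2 * real n * s\<^sup>2)"
    using small[OF q] small[OF r] by (simp add: sum_prob_label_event_1)
  finally show ?thesis unfolding K_def edge_deviation_def .
qed

section \<open>Degrees\<close>

definition node_degree :: "nat \<Rightarrow> 'a \<Rightarrow> real" where
  "node_degree i \<omega> = (\<Sum>j\<in>{1..n} - {i}. of_bool (X i j \<omega>))"

lemma node_degree_measurable: "i \<in> {1..n} \<Longrightarrow> node_degree i \<in> borel_measurable M"
  unfolding node_degree_def using random_edge by (intro borel_measurable_sum) auto

definition degree_deviation :: "real \<Rightarrow> nat \<Rightarrow> 'a set" where
  "degree_deviation d i = (\<Union>z\<in>labelings. label_event z \<inter>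
    {\<omega> \<in> space M. \<bar>node_degree i \<omega> - (n * pi_bar Q \<alpha> \<pi> (z i) - 1 / 2)\<bar> \<ge> real n * d / 4})"

lemma degree_deviation_sets:
  assumes "i \<in> {1..n}"
  shows "degree_deviation d i \<in> events"
proof -
  have [measurable]: "node_degree i \<in> borel_measurable M" by (rule node_degree_measurable[OF assms])
  show ?thesis
    unfolding degree_deviation_def
    by (intro sets.finite_UN finite_labelings sets.Int label_event_sets) measurable
qed

text \<open>The edges at \<open>i\<close> are independent under their sorted indices; the symmetry
  of \<open>X\<close> and of \<open>\<pi>\<close> undoes the sorting in the sum and in the
  product.\<close>

lemma cond_degree_mgf:
  assumes z: "z \<in> labelings" and pos: "prob (label_event z) > 0" and i: "i \<in> {1..n}"
  shows "integrable (uniform_measure M (label_event z)) (\<lambda>\<omega>. exp (l * node_degree i \<omega>))" (is ?int)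
    and "(\<integral>\<omega>. exp (l * node_degree i \<omega>) \<partial>uniform_measure M (label_event z)) =
      (\<Prod>j\<in>{1..n} - {i}. 1 - \<pi> (z i) (z j) + \<pi> (z i) (z j) * exp l)" (is ?eq)
proof -
  let ?N = "uniform_measure M (label_event z)"
  let ?E = "{(a, b). 1 \<le> a \<and> a < b \<and> b \<le> n \<and> (a = i \<or> b = i)}"
  interpret N: prob_space ?N by (rule prob_space_cond[OF pos])
  have fin: "finite ?E" by (rule finite_subset[of _ "{1..n} \<times> {1..n}"]) auto
  have indep: "N.indep_vars (\<lambda>_. count_space UNIV) (\<lambda>(i, j). X i j) ?E"
    using cond_indep[OF pos] by (rule N.indep_vars_subset) auto
  have p: "measure ?N {\<omega> \<in> space ?N. (case e of (a, b) \<Rightarrow> X a b) \<omega>} = (case e of (a, b) \<Rightarrow> \<pi> (z a) (z b))"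
    if "e \<in> ?E" for e
    using cond_edge_prob[OF z pos] that by (cases e) auto
  have deg: "(\<Sum>e\<in>?E. of_bool ((case e of (a, b) \<Rightarrow> X a b) \<omega>)) = node_degree i \<omega>"
    if "\<omega> \<in> space ?N" for \<omega>
  proof -
    have "(\<Sum>e\<in>?E. of_bool ((case e of (a, b) \<Rightarrow> X a b) \<omega>) :: real) =
        (\<Sum>j\<in>{1..n} - {i}. of_bool (X (min i j) (max i j) \<omega>))"
      by (subst sum.reindex_bij_betw[OF bij_betw_incident_pair[OF i], symmetric]) simp
    also have "\<dots> = node_degree i \<omega>"
      unfolding node_degree_def
    proof (rule sum.cong[OF refl])
      fix j assume "j \<in> {1..n} - {i}"
      then have "X (min i j) (max i j) \<omega> = X i j \<omega>"
        using edges_sym[of i j \<omega>] i that by (cases "i \<le> j") (auto simp: min_def max_def)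
      then show "of_bool (X (min i j) (max i j) \<omega>) = of_bool (X i j \<omega>)" by simp
    qed
    finally show ?thesis .
  qed
  have "integrable ?N (\<lambda>\<omega>. exp (l * (\<Sum>e\<in>?E. of_bool ((case e of (a, b) \<Rightarrow> X a b) \<omega>)))) \<longleftrightarrow> ?int"
    by (rule Bochner_Integration.integrable_cong[OF refl],
        rule arg_cong[where f = "\<lambda>x. exp (l * x)"], erule deg)
  then show ?int using N.expectation_exp_sum_bernoulli(1)[OF fin indep p] by blast
  have "(\<integral>\<omega>. exp (l * node_degree i \<omega>) \<partial>?N) =
      (\<integral>\<omega>. exp (l * (\<Sum>e\<in>?E. of_bool ((case e of (a, b) \<Rightarrow> X a b) \<omega>))) \<partial>?N)"
    by (rule Bochner_Integration.integral_cong[OF refl],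
        rule arg_cong[where f = "\<lambda>x. exp (l * x)"], erule deg[symmetric])
  also have "\<dots> = (\<Prod>e\<in>?E. 1 - (case e of (a, b) \<Rightarrow> \<pi> (z a) (z b)) + (case e of (a, b) \<Rightarrow> \<pi> (z a) (z b)) * exp l)"
    by (rule N.expectation_exp_sum_bernoulli(2)[OF fin indep p])
  also have "\<dots> = (\<Prod>j\<in>{1..n} - {i}. 1 - \<pi> (z (min i j)) (z (max i j)) + \<pi> (z (min i j)) (z (max i j)) * exp l)"
    by (subst prod.reindex_bij_betw[OF bij_betw_incident_pair[OF i], symmetric]) simp
  also have "\<dots> = (\<Prod>j\<in>{1..n} - {i}. 1 - \<pi> (z i) (z j) + \<pi> (z i) (z j) * exp l)"
  proof (rule prod.cong[OF refl])
    fix j assume "j \<in> {1..n} - {i}"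
    then have "\<pi> (z (min i j)) (z (max i j)) = \<pi> (z i) (z j)"
      using pi_sym[of "z i" "z j"] labelings_range[OF z] i by (cases "i \<le> j") (auto simp: min_def max_def)
    then show "1 - \<pi> (z (min i j)) (z (max i j)) + \<pi> (z (min i j)) (z (max i j)) * exp l =
      1 - \<pi> (z i) (z j) + \<pi> (z i) (z j) * exp l" by simp
  qed
  finally show ?eq .
qed

lemma pi_bar_range:
  assumes "q \<in> {1..Q}"
  shows "pi_bar Q \<alpha> \<pi> q \<in> {0..1}"
proof -
  have "pi_bar Q \<alpha> \<pi> q \<le> (\<Sum>r\<in>{1..Q}. \<alpha> r)"
    unfolding pi_bar_def using alpha_nonneg pi_range[OF assms] by (intro sum_mono mult_left_le) auto
  moreover have "pi_bar Q \<alpha> \<pi> q \<ge> 0"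
    unfolding pi_bar_def using alpha_nonneg pi_range[OF assms] by (intro sum_nonneg mult_nonneg_nonneg) auto
  ultimately show ?thesis using alpha_sum by simp
qed

text \<open>The moment generating function of a Bernoulli variable is affine in its parameter, so
  averaging over the label of the far endpoint just replaces \<open>\<pi> q r\<close> by
  \<open>pi_bar\<close>. The \<open>n - 1\<close> resulting factors meet the centre
  \<open>n * pi_bar - 1 / 2\<close>, and \<open>l * (1 / 2 - pi_bar)\<close> is what remains
  uncancelled.\<close>

lemma sum_degree_mgf_le:
  assumes i: "i \<in> {1..n}"
  shows "(\<Sum>z\<in>labelings. prob (label_event z) * (exp (- l * (n * pi_bar Q \<alpha> \<pi> (z i) - 1 / 2)) *
      (\<Prod>j\<in>{1..n} - {i}. 1 - \<pi> (z i) (z j) + \<pi> (z i) (z j) * exp l)))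
    \<le> (\<Sum>q\<in>{1..Q}. \<alpha> q * exp (l * (1 / 2 - pi_bar Q \<alpha> \<pi> q) + (real n - 1) * (l\<^sup>2 / 8)))"
proof -
  define h where "h q = \<alpha> q * exp (- l * (n * pi_bar Q \<alpha> \<pi> q - 1 / 2))" for q
  define G where "G q r = \<alpha> r * (1 - \<pi> q r + \<pi> q r * exp l)" for q r
  have "(\<Sum>z\<in>labelings. prob (label_event z) * (exp (- l * (n * pi_bar Q \<alpha> \<pi> (z i) - 1 / 2)) *
      (\<Prod>j\<in>{1..n} - {i}. 1 - \<pi> (z i) (z j) + \<pi> (z i) (z j) * exp l)))
    = (\<Sum>z\<in>labelings. h (z i) * (\<Prod>j\<in>{1..n} - {i}. G (z i) (z j)))"
  proof (rule sum.cong[OF refl])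
    fix z assume "z \<in> labelings"
    then have "prob (label_event z) = \<alpha> (z i) * (\<Prod>j\<in>{1..n} - {i}. \<alpha> (z j))"
      using i prod.remove[of "{1..n}" i "\<lambda>j. \<alpha> (z j)"] by (simp add: prob_label_event)
    then show "prob (label_event z) * (exp (- l * (n * pi_bar Q \<alpha> \<pi> (z i) - 1 / 2)) *
      (\<Prod>j\<in>{1..n} - {i}. 1 - \<pi> (z i) (z j) + \<pi> (z i) (z j) * exp l)) =
      h (z i) * (\<Prod>j\<in>{1..n} - {i}. G (z i) (z j))"
      by (simp add: h_def G_def prod.distrib)
  qed
  also have "\<dots> = (\<Sum>q\<in>{1..Q}. h q * (\<Sum>r\<in>{1..Q}. G q r) ^ (n - 1))"
    unfolding labelings_def using i by (subst sum_PiE_split_coordinate) auto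
  also have "\<dots> \<le> (\<Sum>q\<in>{1..Q}. \<alpha> q * exp (l * (1 / 2 - pi_bar Q \<alpha> \<pi> q) + (real n - 1) * (l\<^sup>2 / 8)))"
  proof (rule sum_mono)
    fix q assume q: "q \<in> {1..Q}"
    let ?p = "pi_bar Q \<alpha> \<pi> q"
    have "(\<Sum>r\<in>{1..Q}. G q r) = (\<Sum>r\<in>{1..Q}. \<alpha> r) - ?p + ?p * exp l"
      unfolding G_def pi_bar_def sum_distrib_right sum.distrib[symmetric] sum_subtractf[symmetric]
      by (intro sum.cong) (simp_all add: algebra_simps)
    then have G: "(\<Sum>r\<in>{1..Q}. G q r) = 1 - ?p + ?p * exp l" using alpha_sum by simp
    have "1 - ?p + ?p * exp l \<ge> 0"
      using pi_bar_range[OF q] by (intro add_nonneg_nonneg mult_nonneg_nonneg) auto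
    then have "(\<Sum>r\<in>{1..Q}. G q r) ^ (n - 1) \<le> exp (l * ?p + l\<^sup>2 / 8) ^ (n - 1)"
      unfolding G by (intro power_mono bernoulli_mgf_le pi_bar_range[OF q])
    also have "\<dots> = exp ((real n - 1) * (l * ?p + l\<^sup>2 / 8))"
      using n_pos by (simp add: exp_of_nat_mult[symmetric] of_nat_diff)
    finally have "h q * (\<Sum>r\<in>{1..Q}. G q r) ^ (n - 1) \<le> h q * \<dots>"
      using alpha_nonneg[OF q] by (intro mult_left_mono) (auto simp: h_def)
    also have "\<dots> = \<alpha> q * exp (l * (1 / 2 - ?p) + (real n - 1) * (l\<^sup>2 / 8))"
      unfolding h_def mult.assoc by (simp add: algebra_simps flip: exp_add)
    finally show "h q * (\<Sum>r\<in>{1..Q}. G q r) ^ (n - 1) \<le> \<dots>" .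
  qed
  finally show ?thesis .
qed

text \<open>Adding \<open>1 / 2\<close> to the degree plays the role of a constant self-loop. Its bias \<open>1 / 2 - pi_bar\<close> enters the upper and the lower tail with opposite signs,
  so their sum costs a factor \<open>cosh (d * (1 / 2 - pi_bar)) \<le> exp (d\<^sup>2 / 8)\<close>, exactly that of one more
  summand in Hoeffding's lemma. This is why the exponent has \<open>n\<close> rather than \<open>n - 1\<close>.\<close>

lemma prob_degree_deviation:
  fixes d :: real
  assumes i: "i \<in> {1..n}" and d: "d > 0"
  shows "prob (degree_deviation d i) \<le> 2 * exp (- (1 / 8) * real n * d\<^sup>2)"
proof -
  define c where "c z = n * pi_bar Q \<alpha> \<pi> (z i) - 1 / 2" for z
  define P where "P l z = (\<Prod>j\<in>{1..n} - {i}. 1 - \<pi> (z i) (z j) + \<pi> (z i) (z j) * exp l)" for l z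
  define x where "x q = d * (1 / 2 - pi_bar Q \<alpha> \<pi> q)" for q
  define y where "y = (real n - 1) * (d\<^sup>2 / 8)"
  \<comment> \<open>The Chernoff parameter is \<open>d\<close> itself, which minimises
    \<open>n * l\<^sup>2 / 8 - l * (n * d / 4)\<close> over \<open>l\<close> and gives the value
    \<open>- n * d\<^sup>2 / 8\<close>.\<close>
  have "prob (\<Union>z\<in>labelings. label_event z \<inter> {\<omega> \<in> space M. \<bar>node_degree i \<omega> - c z\<bar> \<ge> n * d / 4})
    \<le> (\<Sum>z\<in>labelings. prob (label_event z) *
      (exp (- d * (n * d / 4)) * (exp (- d * c z) * P d z + exp (d * c z) * P (- d) z)))"
  proof (rule prob_UN_label_event_le)
    fix z assume z: "z \<in> labelings"
    have [measurable]: "node_degree i \<in> borel_measurable M" by (rule node_degree_measurable[OF i])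
    show "{\<omega> \<in> space M. \<bar>node_degree i \<omega> - c z\<bar> \<ge> n * d / 4} \<in> events" by measurable
    assume pos: "prob (label_event z) > 0"
    let ?N = "uniform_measure M (label_event z)"
    interpret N: prob_space ?N by (rule prob_space_cond[OF pos])
    have "node_degree i \<in> borel_measurable ?N" by measurable
    from N.prob_abs_diff_ge_Chernoff[OF this d
        cond_degree_mgf(1)[OF z pos i, of d] cond_degree_mgf(1)[OF z pos i, of "- d"], of "n * d / 4" "c z"]
    show "measure ?N {\<omega> \<in> space M. \<bar>node_degree i \<omega> - c z\<bar> \<ge> n * d / 4}
      \<le> exp (- d * (n * d / 4)) * (exp (- d * c z) * P d z + exp (d * c z) * P (- d) z)"
      unfolding cond_degree_mgf(2)[OF z pos i] P_def by simp
  qed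
  also have "\<dots> = exp (- d * (n * d / 4)) * ((\<Sum>z\<in>labelings. prob (label_event z) * (exp (- d * c z) * P d z)) +
      (\<Sum>z\<in>labelings. prob (label_event z) * (exp (- (- d) * c z) * P (- d) z)))"
    unfolding sum.distrib[symmetric] sum_distrib_left
    by (intro sum.cong) (simp_all add: algebra_simps)
  also have "\<dots> \<le> exp (- d * (n * d / 4)) * ((\<Sum>q\<in>{1..Q}. \<alpha> q * exp (x q + y)) + (\<Sum>q\<in>{1..Q}. \<alpha> q * exp (- x q + y)))"
    using sum_degree_mgf_le[OF i, of d] sum_degree_mgf_le[OF i, of "- d"]
    by (intro mult_left_mono add_mono) (simp_all add: c_def P_def x_def y_def)
  also have "(\<Sum>q\<in>{1..Q}. \<alpha> q * exp (x q + y)) + (\<Sum>q\<in>{1..Q}. \<alpha> q * exp (- x q + y)) =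
      (\<Sum>q\<in>{1..Q}. \<alpha> q * (exp y * (exp (x q) + exp (- x q))))"
    unfolding sum.distrib[symmetric] by (intro sum.cong) (simp_all add: algebra_simps exp_add exp_diff exp_minus divide_inverse)
  also have "exp (- d * (n * d / 4)) * \<dots> \<le> exp (- d * (n * d / 4)) *
      (\<Sum>q\<in>{1..Q}. \<alpha> q * (exp y * (2 * exp (d\<^sup>2 / 8))))"
  proof (intro mult_left_mono sum_mono)
    fix q assume q: "q \<in> {1..Q}"
    have "\<bar>1 / 2 - pi_bar Q \<alpha> \<pi> q\<bar> \<le> 1 / 2"
      using pi_bar_range[OF q] unfolding atLeastAtMost_iff by linarith
    then have "(1 / 2 - pi_bar Q \<alpha> \<pi> q)\<^sup>2 \<le> (1 / 2)\<^sup>2" by (simp add: abs_le_square_iff[symmetric])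
    then have "d\<^sup>2 * (1 / 2 - pi_bar Q \<alpha> \<pi> q)\<^sup>2 \<le> d\<^sup>2 * (1 / 2)\<^sup>2" by (rule mult_left_mono) simp
    then have "(x q)\<^sup>2 / 2 \<le> d\<^sup>2 / 8" by (simp add: x_def power_mult_distrib power2_eq_square)
    then have "2 * exp ((x q)\<^sup>2 / 2) \<le> 2 * exp (d\<^sup>2 / 8)" by simp
    then show "exp (x q) + exp (- x q) \<le> 2 * exp (d\<^sup>2 / 8)"
      using exp_add_exp_minus_le[of "x q"] by linarith
  qed (use alpha_nonneg in auto)
  also have "\<dots> = 2 * (exp (- d * (n * d / 4)) * exp y * exp (d\<^sup>2 / 8))"
    unfolding sum_distrib_right[symmetric] alpha_sum by simp
  also have "\<dots> = 2 * exp (- (1 / 8) * real n * d\<^sup>2)"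
    unfolding exp_add[symmetric] y_def by (simp add: field_simps power2_eq_square)
  finally show ?thesis unfolding c_def degree_deviation_def .
qed

section \<open>Recovery and accuracy outside the exceptional events\<close>

definition class_size_deviation_event :: "real \<Rightarrow> nat \<Rightarrow> 'a set" where
  "class_size_deviation_event t q =
    {\<omega> \<in> space M. \<bar>(\<Sum>i\<in>{1..n}. of_bool (Z i \<omega> = q)) - n * \<alpha> q\<bar> \<ge> real n * t}"

definition class_empty_event :: "nat \<Rightarrow> 'a set" where
  "class_empty_event q = {\<omega> \<in> space M. \<forall>i\<in>{1..n}. Z i \<omega> \<noteq> q}"

lemma class_size_deviation_event_sets: "class_size_deviation_event t q \<in> events"
proof -
  note class_size_measurable[measurable]
  show ?thesis unfolding class_size_deviation_event_def by measurable
qed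

lemma class_empty_event_sets: "class_empty_event q \<in> events"
proof -
  have "class_empty_event q = (\<Inter>i\<in>{1..n}. Z i -` (- {q}) \<inter> space M)"
    using n_pos by (auto simp: class_empty_event_def)
  also have "\<dots> \<in> events"
    using n_pos by (intro sets.finite_INT measurable_sets[OF labels_rv]) auto
  finally show ?thesis .
qed

text \<open>The shift \<open>1 / 2\<close> is common to all centres and cancels in differences of
  degrees, so the recentring costs nothing here. Normalising by \<open>n - 1\<close> merely rescales
  the threshold to \<open>n * d / 2 / m\<close>.\<close>

lemma LG_classes_correct:
  fixes d :: real
  assumes n: "n \<ge> 2" and \<omega>: "\<omega> \<in> space M"
    and nonempty: "\<And>q. q \<in> {1..Q} \<Longrightarrow> \<omega> \<notin> class_empty_event q"
    and degrees: "\<And>i. i \<in> {1..n} \<Longrightarrow> \<omega> \<notin> degree_deviation d i"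
    and sep: "\<And>q r. q \<in> {1..Q} \<Longrightarrow> r \<in> {1..Q} \<Longrightarrow> q \<noteq> r \<Longrightarrow>
      \<bar>pi_bar Q \<alpha> \<pi> q - pi_bar Q \<alpha> \<pi> r\<bar> \<ge> d"
    and LG: "LG_classes n Q (\<lambda>i j. X i j \<omega>) C"
    and matched: "labels_matched Q C (true_class n (\<lambda>i. Z i \<omega>))"
    and q: "q \<in> {1..Q}"
  shows "C q = true_class n (\<lambda>i. Z i \<omega>) q"
proof -
  define m where "m = real n - 1"
  have m: "m > 0" using n by (simp add: m_def)
  define c where "c i = n * pi_bar Q \<alpha> \<pi> (Z i \<omega>) - 1 / 2" for i
  have T: "norm_degree n (\<lambda>i j. X i j \<omega>) i = node_degree i \<omega> / m" for i
    by (simp only: norm_degree_def node_degree_def m_def)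
  have dev: "\<bar>node_degree i \<omega> - c i\<bar> < n * d / 4" if i: "i \<in> {1..n}" for i
  proof -
    let ?z = "restrict (\<lambda>i. Z i \<omega>) {1..n}"
    have "?z \<in> labelings" "\<omega> \<in> label_event ?z" using restrict_labels_in_labelings[OF \<omega>] .
    then have "\<not> \<bar>node_degree i \<omega> - (n * pi_bar Q \<alpha> \<pi> (?z i) - 1 / 2)\<bar> \<ge> real n * d / 4"
      using degrees[OF i] \<omega> unfolding degree_deviation_def by blast
    then show ?thesis using i by (simp add: c_def)
  qed
  have diff: "\<bar>norm_degree n (\<lambda>i j. X i j \<omega>) i - norm_degree n (\<lambda>i j. X i j \<omega>) j\<bar> =
      \<bar>node_degree i \<omega> - node_degree j \<omega>\<bar> / m" for i j
    using m by (simp add: T abs_divide flip: diff_divide_distrib)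
  show ?thesis
  proof (rule LG_classes_eq_true_class[OF LG matched Q_pos, where g = "n * d / 2 / m"])
    show "(\<lambda>i. Z i \<omega>) ` {1..n} = {1..Q}"
      using nonempty labels_range \<omega> by (fastforce simp: class_empty_event_def)
  next
    fix i j assume ij: "i \<in> {1..n}" "j \<in> {1..n}" "Z i \<omega> = Z j \<omega>"
    then have "c i = c j" by (simp add: c_def)
    then have "\<bar>node_degree i \<omega> - node_degree j \<omega>\<bar> < n * d / 2"
      using dev[OF ij(1)] dev[OF ij(2)] by linarith
    then show "\<bar>norm_degree n (\<lambda>i j. X i j \<omega>) i - norm_degree n (\<lambda>i j. X i j \<omega>) j\<bar> < n * d / 2 / m"
      unfolding diff using m by (rule divide_strict_right_mono)
  next
    fix i j assume ij: "i \<in> {1..n}" "j \<in> {1..n}" "Z i \<omega> \<noteq> Z j \<omega>"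
    have "c i - c j = n * (pi_bar Q \<alpha> \<pi> (Z i \<omega>) - pi_bar Q \<alpha> \<pi> (Z j \<omega>))"
      by (simp add: c_def algebra_simps)
    then have "\<bar>c i - c j\<bar> = n * \<bar>pi_bar Q \<alpha> \<pi> (Z i \<omega>) - pi_bar Q \<alpha> \<pi> (Z j \<omega>)\<bar>"
      by (simp add: abs_mult)
    also have "\<dots> \<ge> n * d"
      using sep labels_range[OF _ \<omega>] ij by (intro mult_left_mono) auto
    finally have "\<bar>node_degree i \<omega> - node_degree j \<omega>\<bar> > n * d / 2"
      using dev[OF ij(1)] dev[OF ij(2)] by linarith
    then show "\<bar>norm_degree n (\<lambda>i j. X i j \<omega>) i - norm_degree n (\<lambda>i j. X i j \<omega>) j\<bar> > n * d / 2 / m"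
      unfolding diff using m by (rule divide_strict_right_mono)
  qed (rule q)
qed

lemma param_dist_le:
  assumes \<omega>: "\<omega> \<in> space M" and "t > 0"
    and C: "\<And>q. q \<in> {1..Q} \<Longrightarrow> C q = true_class n (\<lambda>i. Z i \<omega>) q"
    and sizes: "\<And>q. q \<in> {1..Q} \<Longrightarrow> \<omega> \<notin> class_size_deviation_event t q"
    and edges: "\<And>q r. q \<in> {1..Q} \<Longrightarrow> r \<in> {1..Q} \<Longrightarrow> \<omega> \<notin> edge_deviation t q r"
  shows "param_dist Q (alpha_hat n C) (pi_hat v (\<lambda>i j. X i j \<omega>) C) \<alpha> \<pi> \<le> t"
proof -
  have n: "real n > 0" using n_pos by simp
  have "\<bar>alpha_hat n C q - \<alpha> q\<bar> \<le> t" if q: "q \<in> {1..Q}" for q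
  proof -
    have "\<bar>real (card (C q)) - n * \<alpha> q\<bar> < n * t"
      using sizes[OF q] \<omega> unfolding class_size_deviation_event_def C[OF q] class_size_eq_sum by auto
    moreover have "alpha_hat n C q - \<alpha> q = (real (card (C q)) - n * \<alpha> q) / n"
      using n by (simp add: alpha_hat_def field_simps)
    ultimately show ?thesis using n by (simp add: abs_divide divide_le_eq mult.commute)
  qed
  moreover have "\<bar>pi_hat v (\<lambda>i j. X i j \<omega>) C q r - \<pi> q r\<bar> \<le> t"
    if q: "q \<in> {1..Q}" and r: "r \<in> {1..Q}" for q r
  proof -
    define z where "z = restrict (\<lambda>i. Z i \<omega>) {1..n}"
    let ?N = "card (class_edges n z q r)"
    have "z \<in> labelings" "\<omega> \<in> label_event z"
      using restrict_labels_in_labelings[OF \<omega>] by (simp_all only: z_def)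
    then have "\<not> \<bar>edge_sum z q r \<omega> - ?N * \<pi> q r\<bar> \<ge> real ?N * t"
      using edges[OF q r] \<omega> unfolding edge_deviation_def by blast
    then have dev: "\<bar>edge_sum z q r \<omega> - ?N * \<pi> q r\<bar> < ?N * t" by simp
    \<comment> \<open>With no pairs the deviation condition would read \<open>0 \<ge> 0\<close> and
      hold. Avoiding \<open>edge_deviation\<close> thus already rules out singleton classes on the
      diagonal, and with them the default value.\<close>
    have "?N \<noteq> 0"
    proof
      assume "?N = 0"
      then show False using dev by (simp only: of_nat_0 mult_zero_left)
    qed
    have "true_class n (\<lambda>i. Z i \<omega>) = true_class n z"
      by (auto simp: true_class_def z_def fun_eq_iff)
    then have "pi_hat v (\<lambda>i j. X i j \<omega>) C q r = pi_hat v (\<lambda>i j. X i j \<omega>) (true_class n z) q r"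
      using C[OF q] C[OF r] by (simp add: pi_hat_def)
    also have "\<dots> = edge_sum z q r \<omega> / ?N"
      unfolding edge_sum_def using edges_sym \<omega> \<open>?N \<noteq> 0\<close> by (intro pi_hat_eq_mean) auto
    finally have "pi_hat v (\<lambda>i j. X i j \<omega>) C q r - \<pi> q r = (edge_sum z q r \<omega> - ?N * \<pi> q r) / ?N"
      using \<open>?N \<noteq> 0\<close> by (simp add: field_simps)
    then show ?thesis using dev \<open>?N \<noteq> 0\<close> by (simp add: abs_divide divide_le_eq mult.commute)
  qed
  ultimately show ?thesis
    unfolding param_dist_def using Q_pos by (subst Max_le_iff) auto
qed

text \<open>The slack \<open>s = n powr (- 1 / 4) / 2\<close> in the class proportions makes the Hoeffding bound
  \<open>exp (- 2 * n * s\<^sup>2)\<close> equal to \<open>exp (- sqrt n / 2)\<close>.\<close>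

lemma edge_count_lower_bound:
  fixes a :: real
  assumes a: "0 \<le> a" "a \<le> 1 / 2" "a \<le> \<alpha> q" "a \<le> \<alpha> r"
    and q: "real (card (true_class n z q)) > n * \<alpha> q - n * (n powr (- 1 / 4) / 2)"
    and r: "real (card (true_class n z r)) > n * \<alpha> r - n * (n powr (- 1 / 4) / 2)"
  shows "real n ^ 2 * (a ^ 2 - real n powr (- 1 / 4)) \<le> 2 * real (card (class_edges n z q r))"
proof (cases "a < n powr (- 1 / 4) / 2")
  \<comment> \<open>When \<open>a\<close> is below the slack, \<open>a ^ 2\<close> is below
    \<open>n powr (- 1 / 4)\<close> and the claimed lower bound is not positive.\<close>
  case True
  have "a ^ 2 \<le> a" using a by (simp add: power2_eq_square mult_left_le)
  then have "a ^ 2 - real n powr (- 1 / 4) \<le> 0" using True a by linarith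
  then have "real n ^ 2 * (a ^ 2 - real n powr (- 1 / 4)) \<le> 0" by (simp add: mult_nonneg_nonpos)
  then show ?thesis using of_nat_0_le_iff[of "card (class_edges n z q r)"] by (metis mult_2 add_nonneg_nonneg order_trans)
next
  case False
  define s where "s = real n powr (- 1 / 4) / 2"
  define x where "x = n * (a - s)"
  define N where "N = real (card (true_class n z q))"
  define N' where "N' = real (card (true_class n z r))"
  have n: "real n \<ge> 1" using n_pos by simp
  have x: "x \<ge> 0" using False by (simp add: x_def s_def)
  have "n * a \<le> n * \<alpha> q" "n * a \<le> n * \<alpha> r" using a by (auto intro: mult_left_mono)
  then have N: "N > x" "N' > x"
    using q r by (simp_all add: N_def N'_def x_def s_def algebra_simps)
  \<comment> \<open>The slack must also pay for the linear loss in \<open>x * (x - 1)\<close>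
    compared with \<open>x * x\<close>. It does: \<open>2 * s * n \<ge> 1\<close> and
    \<open>a \<le> 1 - a\<close> make the surplus \<open>n * (2 * s * n * (1 - a))\<close> at least
    \<open>n * a\<close>.\<close>
  have "real n powr (- 1) \<le> real n powr (- 1 / 4)" using n by (intro powr_mono) auto
  then have "n * (real n powr (- 1)) \<le> n * (real n powr (- 1 / 4))" by (rule mult_left_mono) simp
  then have "2 * s * n \<ge> 1" using n by (simp add: s_def powr_minus mult.commute)
  have "a \<le> 1 * (1 - a)" using a by simp
  also have "1 * (1 - a) \<le> 2 * s * n * (1 - a)"
    using a \<open>2 * s * n \<ge> 1\<close> by (intro mult_right_mono) auto
  finally have "a \<le> 2 * s * n * (1 - a)" .
  then have "n * a \<le> n * (2 * s * n * (1 - a))" by (rule mult_left_mono) simp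
  moreover have "s \<ge> 0" by (simp add: s_def)
  then have "n * s \<ge> 0" "(n * s)\<^sup>2 \<ge> 0" by simp_all
  moreover have "x * (x - 1) - real n ^ 2 * (a ^ 2 - 2 * s) =
      n * (2 * s * n * (1 - a)) - n * a + n * s + (n * s)\<^sup>2"
    by (simp add: x_def power2_eq_square algebra_simps)
  ultimately have W: "real n ^ 2 * (a ^ 2 - 2 * s) \<le> x * (x - 1)" by linarith
  have "x * (x - 1) \<le> 2 * real (card (class_edges n z q r))"
  proof (cases "q = r")
    case True
    \<comment> \<open>Integrality enters here: \<open>N\<close> exceeds the nonnegative
      \<open>x\<close>, so it is at least 1, and \<open>N + x - 1\<close> is nonnegative even when
      \<open>x < 1\<close>.\<close>
    have "N \<ge> 1" using N x by (simp add: N_def)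
    then have "(N - x) * (N + x - 1) \<ge> 0" using N x by (intro mult_nonneg_nonneg) auto
    then have "x * (x - 1) \<le> N * (N - 1)" by (simp add: algebra_simps)
    then show ?thesis using card_class_edges[of n z q r] True by (simp add: N_def)
  next
    case False
    have "x * x \<le> N * N'" using N x by (intro mult_mono) auto
    moreover have "x * (x - 1) \<le> 2 * (x * x)"
      using x mult_nonneg_nonneg[OF x x] by (simp add: algebra_simps)
    ultimately show ?thesis using card_class_edges[of n z q r] False by (simp add: N_def N'_def)
  qed
  then show ?thesis using W by (simp add: s_def)
qed

end

section \<open>Union bound over the exceptional events\<close>

theorem theorem4p3:
  fixes M :: "'a measure"
    and n Q :: nat
    and \<pi> :: "nat \<Rightarrow> nat \<Rightarrow> real"
    and \<alpha> :: "nat \<Rightarrow> real"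
    and Z :: "nat \<Rightarrow> 'a \<Rightarrow> nat"
    and X :: "nat \<Rightarrow> nat \<Rightarrow> 'a \<Rightarrow> bool"
    and C :: "nat \<Rightarrow> 'a \<Rightarrow> nat set"
    and v t \<delta> \<alpha>0 :: real
  assumes "Q \<ge> 2" and "n \<ge> Q"
    and alpha_pos: "\<And>q. q \<in> {1..Q} \<Longrightarrow> \<alpha> q > 0"
    and alpha_sum: "(\<Sum>q\<in>{1..Q}. \<alpha> q) = 1"
    and pi_sym: "\<And>q r. q \<in> {1..Q} \<Longrightarrow> r \<in> {1..Q} \<Longrightarrow> \<pi> q r = \<pi> r q"
    and pi_range: "\<And>q r. q \<in> {1..Q} \<Longrightarrow> r \<in> {1..Q} \<Longrightarrow> \<pi> q r \<in> {0..1}"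
    and separated: "\<And>q r. q \<in> {1..Q} \<Longrightarrow> r \<in> {1..Q} \<Longrightarrow> q \<noteq> r \<Longrightarrow>
          pi_bar Q \<alpha> \<pi> q \<noteq> pi_bar Q \<alpha> \<pi> r"
    and delta: "\<delta> = sep Q \<alpha> \<pi>"
    and alpha0: "\<alpha>0 = alpha_min Q \<alpha>"
    and model: "sbm M n Q \<pi> \<alpha> Z X"
    and C_rv: "\<And>q. q \<in> {1..Q} \<Longrightarrow> C q \<in> measurable M (count_space UNIV)"
    and C_LG: "\<And>\<omega>. \<omega> \<in> space M \<Longrightarrow> LG_classes n Q (\<lambda>i j. X i j \<omega>) (\<lambda>q. C q \<omega>)"
    and C_labels: "\<And>\<omega>. \<omega> \<in> space M \<Longrightarrow>
          labels_matched Q (\<lambda>q. C q \<omega>) (true_class n (\<lambda>i. Z i \<omega>))"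
    and "v \<in> {0..1}"
    and "t > 0"
  shows "measure M {\<omega> \<in> space M.
           param_dist Q (alpha_hat n (\<lambda>q. C q \<omega>)) (pi_hat v (\<lambda>i j. X i j \<omega>) (\<lambda>q. C q \<omega>)) \<alpha> \<pi> > t}
         \<le> 2 * real Q ^ 2 *
             (exp (- (real n ^ 2 * t ^ 2 * (\<alpha>0 ^ 2 - real n powr (- 1 / 4))))
              + 4 * exp (- (1 / 2) * sqrt (real n)))
           + 2 * real Q * exp (- 2 * real n * t ^ 2)
           + 2 * real n * exp (- (1 / 8) * real n * \<delta> ^ 2)
           + real Q * (1 - \<alpha>0) ^ n"
proof -
  interpret sbm M n Q \<pi> \<alpha> Z X by (rule model)
  interpret sbm_params M n Q \<pi> \<alpha> Z X
  proof unfold_locales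
    show "\<And>q. q \<in> {1..Q} \<Longrightarrow> \<alpha> q \<ge> 0" using alpha_pos by (simp add: less_imp_le)
  qed (use \<open>Q \<ge> 2\<close> \<open>n \<ge> Q\<close> alpha_sum pi_sym pi_range in auto)
  have n: "n \<ge> 2" using \<open>Q \<ge> 2\<close> \<open>n \<ge> Q\<close> by simp
  define gaps where "gaps = {\<bar>pi_bar Q \<alpha> \<pi> q - pi_bar Q \<alpha> \<pi> r\<bar> | q r. q \<in> {1..Q} \<and> r \<in> {1..Q} \<and> q \<noteq> r}"
  have "finite gaps"
    by (rule finite_subset[of _ "(\<lambda>(q, r). \<bar>pi_bar Q \<alpha> \<pi> q - pi_bar Q \<alpha> \<pi> r\<bar>) ` ({1..Q} \<times> {1..Q})"])
      (auto simp: gaps_def)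
  have \<delta>_le: "\<bar>pi_bar Q \<alpha> \<pi> q - pi_bar Q \<alpha> \<pi> r\<bar> \<ge> \<delta>" if "q \<in> {1..Q}" "r \<in> {1..Q}" "q \<noteq> r" for q r
  proof -
    have "\<bar>pi_bar Q \<alpha> \<pi> q - pi_bar Q \<alpha> \<pi> r\<bar> \<in> gaps" using that unfolding gaps_def by blast
    then show ?thesis unfolding delta sep_def gaps_def[symmetric] by (rule Min_le[OF \<open>finite gaps\<close>])
  qed
  have "\<bar>pi_bar Q \<alpha> \<pi> 1 - pi_bar Q \<alpha> \<pi> 2\<bar> \<in> gaps"
    unfolding gaps_def using \<open>Q \<ge> 2\<close> by fastforce
  then have "gaps \<noteq> {}" by blast
  then have \<delta>_pos: "\<delta> > 0"
    unfolding delta sep_def gaps_def[symmetric] using \<open>finite gaps\<close> separated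
    by (subst Min_gr_iff) (auto simp: gaps_def)
  have \<alpha>0_le: "\<alpha>0 \<le> \<alpha> q" if "q \<in> {1..Q}" for q
    unfolding alpha0 alpha_min_def using that by (intro Min_le) auto
  have \<alpha>0_nonneg: "\<alpha>0 \<ge> 0"
    unfolding alpha0 alpha_min_def using alpha_nonneg \<open>Q \<ge> 2\<close> by (subst Min_ge_iff) auto
  \<comment> \<open>Two classes already force \<open>\<alpha>0 \<le> 1 / 2\<close>, which the count
    of pairs uses in the form \<open>a \<le> 1 - a\<close>.\<close>
  have "(\<Sum>q\<in>{1, 2}. \<alpha> q) \<le> (\<Sum>q\<in>{1..Q}. \<alpha> q)"
    using alpha_nonneg \<open>Q \<ge> 2\<close> by (intro sum_mono2) auto
  then have "\<alpha> 1 + \<alpha> 2 \<le> 1" using alpha_sum by simp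
  then have \<alpha>0_half: "\<alpha>0 \<le> 1 / 2" using \<alpha>0_le[of 1] \<alpha>0_le[of 2] \<open>Q \<ge> 2\<close> by auto

  let ?F = "\<Union>q\<in>{1..Q}. class_empty_event q"
  let ?D = "\<Union>i\<in>{1..n}. degree_deviation \<delta> i"
  let ?H = "\<Union>q\<in>{1..Q}. class_size_deviation_event t q"
  let ?P = "\<Union>(q, r)\<in>{1..Q} \<times> {1..Q}. edge_deviation t q r"
  let ?A = "exp (- (real n ^ 2 * t ^ 2 * (\<alpha>0 ^ 2 - real n powr (- 1 / 4))))"
  let ?B = "exp (- (1 / 2) * sqrt (real n))"
  have sets: "?F \<in> events" "?D \<in> events" "?H \<in> events" "?P \<in> events"
    using class_empty_event_sets degree_deviation_sets class_size_deviation_event_sets edge_deviation_sets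
    by (auto intro!: sets.finite_UN)
  have subset: "{\<omega> \<in> space M.
      param_dist Q (alpha_hat n (\<lambda>q. C q \<omega>)) (pi_hat v (\<lambda>i j. X i j \<omega>) (\<lambda>q. C q \<omega>)) \<alpha> \<pi> > t}
    \<subseteq> ?P \<union> ?H \<union> ?D \<union> ?F"
  proof (rule subsetI, rule ccontr)
    fix \<omega> assume \<omega>: "\<omega> \<in> {\<omega> \<in> space M.
      param_dist Q (alpha_hat n (\<lambda>q. C q \<omega>)) (pi_hat v (\<lambda>i j. X i j \<omega>) (\<lambda>q. C q \<omega>)) \<alpha> \<pi> > t}"
      and good: "\<omega> \<notin> ?P \<union> ?H \<union> ?D \<union> ?F"
    then have sp: "\<omega> \<in> space M" by simp
    have "C q \<omega> = true_class n (\<lambda>i. Z i \<omega>) q" if "q \<in> {1..Q}" for q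
      by (rule LG_classes_correct[OF n sp _ _ \<delta>_le C_LG[OF sp] C_labels[OF sp] that]) (use good in auto)
    then have "param_dist Q (alpha_hat n (\<lambda>q. C q \<omega>)) (pi_hat v (\<lambda>i j. X i j \<omega>) (\<lambda>q. C q \<omega>)) \<alpha> \<pi> \<le> t"
      by (rule param_dist_le[OF sp \<open>t > 0\<close>]) (use good in auto)
    then show False using \<omega> by simp
  qed
  have "prob ?F \<le> (\<Sum>q\<in>{1..Q}. prob (class_empty_event q))"
    using class_empty_event_sets by (intro measure_UNION_le) auto
  also have "\<dots> \<le> (\<Sum>q\<in>{1..Q}. (1 - \<alpha>0) ^ n)"
  proof (rule sum_mono)
    fix q assume q: "q \<in> {1..Q}"
    \<comment> \<open>This keeps \<open>1 - \<alpha> q\<close> nonnegative, as monotonicity of the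
      power requires.\<close>
    have "\<alpha> q \<le> (\<Sum>q\<in>{1..Q}. \<alpha> q)" using q alpha_nonneg by (intro member_le_sum) auto
    then show "prob (class_empty_event q) \<le> (1 - \<alpha>0) ^ n"
      unfolding class_empty_event_def prob_class_empty[OF q]
      using \<alpha>0_le[OF q] alpha_sum by (intro power_mono) auto
  qed
  finally have F: "prob ?F \<le> real Q * (1 - \<alpha>0) ^ n" by simp
  have "prob ?D \<le> (\<Sum>i\<in>{1..n}. prob (degree_deviation \<delta> i))"
    using degree_deviation_sets by (intro measure_UNION_le) auto
  also have "\<dots> \<le> (\<Sum>i\<in>{1..n}. 2 * exp (- (1 / 8) * real n * \<delta>\<^sup>2))"
    by (intro sum_mono prob_degree_deviation \<delta>_pos)
  finally have D: "prob ?D \<le> 2 * real n * exp (- (1 / 8) * real n * \<delta> ^ 2)" by simp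
  have "prob ?H \<le> (\<Sum>q\<in>{1..Q}. prob (class_size_deviation_event t q))"
    using class_size_deviation_event_sets by (intro measure_UNION_le) auto
  also have "\<dots> \<le> (\<Sum>q\<in>{1..Q}. 2 * exp (- 2 * real n * t\<^sup>2))"
    unfolding class_size_deviation_event_def
    using \<open>t > 0\<close> by (intro sum_mono class_size_deviation_abs) auto
  finally have H: "prob ?H \<le> 2 * real Q * exp (- 2 * real n * t ^ 2)" by simp
  have "prob ?P \<le> (\<Sum>(q, r)\<in>{1..Q} \<times> {1..Q}. prob (edge_deviation t q r))"
    using edge_deviation_sets by (simp add: case_prod_beta measure_UNION_le)
  also have "\<dots> \<le> (\<Sum>(q, r)\<in>{1..Q} \<times> {1..Q}. 2 * ?A + 4 * ?B)"
  proof (rule sum_mono, clarify)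
    fix q r assume q: "q \<in> {1..Q}" and r: "r \<in> {1..Q}"
    let ?s = "real n powr (- 1 / 4) / 2"
    have "prob (edge_deviation t q r) \<le>
        2 * exp (- (real n ^ 2 * (\<alpha>0 ^ 2 - real n powr (- 1 / 4))) * t\<^sup>2) + 4 * exp (- 2 * real n * ?s\<^sup>2)"
      using edge_count_lower_bound[OF \<alpha>0_nonneg \<alpha>0_half \<alpha>0_le[OF q] \<alpha>0_le[OF r]] \<open>t > 0\<close>
      by (intro prob_edge_deviation[OF q r]) auto
    also have "- (real n ^ 2 * (\<alpha>0 ^ 2 - real n powr (- 1 / 4))) * t\<^sup>2 =
        - (real n ^ 2 * t ^ 2 * (\<alpha>0 ^ 2 - real n powr (- 1 / 4)))"
      by simp
    also have "- 2 * real n * ?s\<^sup>2 = - (1 / 2) * sqrt (real n)"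
    proof -
      have "(real n powr (- 1 / 4))\<^sup>2 = real n powr (- (1 / 2))"
        using n by (simp add: powr_power)
      also have "\<dots> = inverse (sqrt (real n))"
        by (simp only: powr_minus powr_half_sqrt of_nat_0_le_iff)
      finally have "real n * (real n powr (- 1 / 4))\<^sup>2 = real n / sqrt (real n)"
        by (simp only: divide_inverse)
      also have "\<dots> = sqrt (real n)" by (rule real_div_sqrt) simp
      finally show ?thesis by (simp add: power_divide)
    qed
    finally show "prob (edge_deviation t q r) \<le> 2 * ?A + 4 * ?B" .
  qed
  also have "\<dots> = real Q ^ 2 * (2 * ?A + 4 * ?B)"
    by (simp add: card_cartesian_product power2_eq_square)
  \<comment> \<open>The labelings with a small class cost \<open>4 * ?B\<close> per pair of labels;
    rounding up to \<open>8 * ?B\<close> gives the stated form.\<close>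
  also have "\<dots> \<le> real Q ^ 2 * (2 * (?A + 4 * ?B))" by (intro mult_left_mono) auto
  also have "\<dots> = 2 * real Q ^ 2 * (?A + 4 * ?B)" by (simp only: mult_ac)
  finally have P: "prob ?P \<le> 2 * real Q ^ 2 * (?A + 4 * ?B)" .
  have "prob {\<omega> \<in> space M.
      param_dist Q (alpha_hat n (\<lambda>q. C q \<omega>)) (pi_hat v (\<lambda>i j. X i j \<omega>) (\<lambda>q. C q \<omega>)) \<alpha> \<pi> > t}
    \<le> prob (?P \<union> ?H \<union> ?D \<union> ?F)"
    using sets by (intro finite_measure_mono[OF subset]) auto
  also have "\<dots> \<le> prob ?P + prob ?H + prob ?D + prob ?F"
    using sets by (intro order_trans[OF measure_Un_le] add_mono order_refl) auto
  finally show ?thesis using P H D F by linarith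
qed

end
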